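(* Let $n\ge 5$ be an integer, let $N=2^n$, and let $F\colon\mathbb F_2^n\to\mathbb F_2^n$ be an APN function. Then \[ \mathcal L(F)\le \begin{cases} N-10,& n\text{ even},\\ N-6,& n\text{ odd}. \end{cases} \]
   Context: A function $F\colon\mathbb F_2^n\to\mathbb F_2^n$ is almost perfect nonlinear (APN) if for every $h\in\mathbb F_2^n\setminus\{0\}$ and every $y\in\mathbb F_2^n$ the equation $F(x+h)+F(x)=y$ has at most two solutions $x\in\mathbb F_2^n$. For $b\in\mathbb F_2^n$ let $f_b=b\cdot F\colon\mathbb F_2^n\to\mathbb F_2$, where $\cdot$ is the usual dot product over $\mathbb F_2$. For a Boolean function $f\colon\mathbb F_2^n\to\mathbb F_2$ the Walsh transform is $W_f(a)=\sum_{x\in\mathbb F_2^n}(-1)^{f(x)+a\cdot x}$ for $a\in\mathbb F_2^n$. The linearity of $F$ is $\mathcal L(F)=\max\{|W_{f_b}(a)| : a\in\mathbb F_2^n,\ b\in\mathbb F_2^n\setminus\{0\}\}$. *)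

theory Defs
  imports "HOL-Analysis.Finite_Cartesian_Product" "HOL-Library.Z2"
begin

text \<open>The space $F_2^n$ is \<^typ>\<open>bit ^ 'n\<close> with $n$ = \<^term>\<open>CARD('n)\<close>.\<close>

instance bit :: finite
proof
  have "(UNIV :: bit set) = {0, 1}"
    by auto
  then show "finite (UNIV :: bit set)"
    by (metis finite.emptyI finite_insert)
qed

definition apn :: "(bit ^ 'n \<Rightarrow> bit ^ 'n) \<Rightarrow> bool" where
  "apn F \<longleftrightarrow> (\<forall>h y. h \<noteq> 0 \<longrightarrow> card {x. F (x + h) + F x = y} \<le> 2)"

definition bdot :: "bit ^ 'n \<Rightarrow> bit ^ 'n \<Rightarrow> bit" where
  "bdot a x = (\<Sum>i\<in>UNIV. a $ i * x $ i)"

definition component :: "(bit ^ 'n \<Rightarrow> bit ^ 'n) \<Rightarrow> bit ^ 'n \<Rightarrow> bit ^ 'n \<Rightarrow> bit" where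
  "component F b = (\<lambda>x. bdot b (F x))"

text \<open>The exponent of $-1$ is computed in $F_2$ and then read as the natural number 0 or 1.\<close>

definition walsh :: "(bit ^ 'n \<Rightarrow> bit) \<Rightarrow> bit ^ 'n \<Rightarrow> int" where
  "walsh f a = (\<Sum>x\<in>UNIV. (- 1) ^ of_bit (f x + bdot a x))"

definition linearity :: "(bit ^ 'n \<Rightarrow> bit ^ 'n) \<Rightarrow> int" where
  "linearity F = Max {\<bar>walsh (component F b) a\<bar> | a b. b \<noteq> 0}"

text \<open>The maximum is taken over a finite nonempty set.\<close>

lemma linearity_set_finite_nonempty:
  fixes F :: "bit ^ 'n \<Rightarrow> bit ^ 'n"
  defines "S \<equiv> {\<bar>walsh (component F b) a\<bar> | a b. b \<noteq> 0}"
  shows "finite S" and "S \<noteq> {}"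
proof -
  have "S \<subseteq> (\<lambda>(a, b). \<bar>walsh (component F b) a\<bar>) ` UNIV"
    unfolding S_def by auto
  then show "finite S"
    by (rule finite_subset) simp
  have "(1 :: bit ^ 'n) \<noteq> 0"
    by (simp add: vec_eq_iff)
  then show "S \<noteq> {}"
    unfolding S_def by blast
qed

end

theory Submission
  imports Defs
begin

text \<open>
  A Walsh coefficient of the component \<open>b \<bullet> F\<close> with absolute value \<open>N - 2 * d\<close>, where
  \<open>N = 2\<^sup>n\<close>, means that this component agrees with an affine function outside \<open>d\<close> points.
  After an affine change of \<open>F\<close>, the graph of \<open>F\<close> over the remaining points is a set \<open>A\<close> of
  \<open>N - d\<close> pairs \<open>(x, y)\<close> with \<open>b \<bullet> y = 0\<close>, and the APN property says that \<open>A\<close> is a Sidon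
  set: four distinct points never have sum 0. Subsets of such graphs are again such graphs.
  So the theorem says that \<open>d = 2\<close> is impossible for odd \<open>n\<close> (\<open>no_two_missing\<close>), and that
  \<open>d = 3\<close> and \<open>d = 4\<close> are impossible for even \<open>n\<close> (\<open>no_three_missing\<close>, \<open>no_four_missing\<close>).

  Let \<open>psi p\<close> be the sum of the character \<open>p\<close> over \<open>A\<close>. The Sidon property fixes the second
  and the fourth moment of \<open>psi\<close>. The characters \<open>p = (u, v)\<close> with \<open>v \<in> {0, b}\<close> are called
  bad; on them \<open>psi\<close> is essentially a sum over the \<open>d\<close> missing points. On all other
  characters the moments force \<open>psi\<^sup>2\<close> to be close to \<open>N\<close>, with an error that depends on
  \<open>d\<close>. On the other hand \<open>psi\<close> is an integer whose residue modulo 4 is known: with \<open>\<sigma>\<close> the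
  sum of all points of \<open>A\<close>, it is \<open>N - d\<close> or \<open>N - d + 2\<close> according to the sign of the
  character at \<open>\<sigma>\<close>. A quartic polynomial in \<open>psi\<close> whose roots are consecutive members of
  this residue class is nonnegative, and its sum over the characters that are not bad can be
  computed.

  For odd \<open>n\<close> the square root of \<open>N\<close> is irrational, and for \<open>d = 2\<close> the computed sum is
  negative. For even \<open>n\<close> and \<open>d = 3\<close> it is 0 at most, so all these values of \<open>psi\<close> are roots
  of the quartic, and \<open>(psi + 1)\<^sup>2\<close> takes only the two values \<open>N + 4 \<plusminus> 4 * sqrt N\<close>. Summing
  over the characters \<open>(0, v)\<close> gives a contradiction modulo a power of 2, by the argument
  that shows that bent functions have few coordinates.

  For even \<open>n\<close> and \<open>d = 4\<close> one has to look at \<open>psi\<close> modulo 8, which is a quadratic function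
  of the character (\<open>psi_four_term\<close>). Let \<open>K\<close> be the group of characters that are 1 at \<open>\<sigma>\<close>.
  The subset \<open>Q\<close> of \<open>K\<close> where \<open>psi\<close> is 4 modulo 8 contains 0, hence has density at least 1/4
  in \<open>K\<close>; the moments allow hardly more, and by \<open>quadratic_density\<close> \<open>Q\<close> is a subgroup of
  index 4. This excludes \<open>\<sigma> = 0\<close> and yields \<open>psi = \<plusminus>sqrt N \<plusminus> 2\<close> off \<open>K\<close>. The second sign is
  again quadratic, with \<open>Q\<close> in its radical, so it has a very large Fourier coefficient. Read
  in terms of the third moment of \<open>psi\<close>, this provides a point that can be added to \<open>A\<close>, and
  the case \<open>d = 3\<close> applies.
\<close>

section \<open>Characters of pairs of bit vectors\<close>

lemma bit_add_self [simp]: "(x :: bit) + x = 0"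
  by (cases x) auto

lemma vec_add_self [simp]: "(x :: bit ^ 'n) + x = 0"
  by (simp add: vec_eq_iff)

lemma pair_add_self [simp]: "(v :: (bit ^ 'n) \<times> (bit ^ 'n)) + v = 0"
  by (simp add: prod_eq_iff)

lemma vec_add_eq_0 [simp]: "(x :: bit ^ 'n) + y = 0 \<longleftrightarrow> x = y"
  by (metis add_right_cancel vec_add_self)

lemma pair_add_eq_0 [simp]: "(v :: (bit ^ 'n) \<times> (bit ^ 'n)) + w = 0 \<longleftrightarrow> v = w"
  by (metis add_right_cancel pair_add_self)

lemma vec_add_self_left [simp]: "(x :: bit ^ 'n) + (x + y) = y"
  by (simp flip: add.assoc)

lemma pair_add_self_left [simp]: "(v :: (bit ^ 'n) \<times> (bit ^ 'n)) + (v + w) = w"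
  by (simp flip: add.assoc)

lemma pair_add_eq_iff: "(v :: (bit ^ 'n) \<times> (bit ^ 'n)) + w = u \<longleftrightarrow> v = u + w"
  by (metis add.commute pair_add_self_left)

lemma card_bit [simp]: "CARD(bit) = 2"
proof -
  have "(UNIV :: bit set) = {0, 1}" by auto
  then have "CARD(bit) = card {0, 1 :: bit}" by (rule arg_cong)
  also have "\<dots> = 2" by (simp add: card_insert_if)
  finally show ?thesis .
qed

lemma bdot_add_left: "bdot (a + b) x = bdot a x + bdot b x"
  by (simp only: bdot_def vector_add_component distrib_right sum.distrib)

lemma bdot_add_right: "bdot a (x + y) = bdot a x + bdot a y"
  by (simp only: bdot_def vector_add_component distrib_left sum.distrib)

lemma bdot_zero [simp]: "bdot 0 x = 0" "bdot a 0 = 0"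
  by (simp_all add: bdot_def)

lemma bdot_commute: "bdot a x = bdot x a"
  by (simp only: bdot_def mult.commute)

lemma bdot_axis: "bdot a (axis i 1) = a $ i"
  by (simp add: bdot_def axis_def if_distrib cong: if_cong)

lemma bdot_nondegenerate:
  assumes "x \<noteq> 0" obtains a where "bdot a x = 1"
proof -
  obtain i where "x $ i \<noteq> 0" using assms by (auto simp: vec_eq_iff)
  then have "bdot (axis i 1) x = 1" by (simp add: bdot_commute[of _ x] bdot_axis)
  then show thesis by (rule that)
qed

text \<open>The pairing identifies the group with its own character group, so characters and points
  are both written as pairs; the first argument is thought of as the character.\<close>

definition chi :: "(bit ^ 'n) \<times> (bit ^ 'n) \<Rightarrow> (bit ^ 'n) \<times> (bit ^ 'n) \<Rightarrow> int" where
  "chi p v = (- 1) ^ of_bit (bdot (fst p) (fst v) + bdot (snd p) (snd v))"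

lemma minus_one_of_bit_add:
  "(- 1 :: int) ^ of_bit (x + y) = (- 1) ^ of_bit x * (- 1) ^ of_bit y"
  by (cases x; cases y) auto

lemma chi_add_right: "chi p (v + w) = chi p v * chi p w"
  by (simp only: chi_def bdot_add_right fst_add snd_add minus_one_of_bit_add mult_ac)

lemma chi_add_left: "chi (p + q) v = chi p v * chi q v"
  by (simp only: chi_def bdot_add_left fst_add snd_add minus_one_of_bit_add mult_ac)

lemma chi_zero [simp]: "chi p 0 = 1" "chi 0 v = 1"
  by (simp_all add: chi_def)

lemma chi_cases: "chi p v = 1 \<or> chi p v = - 1"
  by (auto simp: chi_def)

lemma chi_square [simp]: "chi p v * chi p v = 1"
  using chi_cases[of p v] by auto

lemma chi_commute: "chi p v = chi v p"
  by (simp only: chi_def bdot_commute)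

lemma chi_nondegenerate:
  assumes "v \<noteq> 0" obtains p where "chi p v = - 1"
proof (cases "fst v = 0")
  case True
  then have "snd v \<noteq> 0" using assms by (simp add: prod_eq_iff)
  then obtain b where "bdot b (snd v) = 1" by (rule bdot_nondegenerate)
  then have "chi (0, b) v = - 1" by (simp add: chi_def)
  then show thesis by (rule that)
next
  case False
  then obtain a where "bdot a (fst v) = 1" by (rule bdot_nondegenerate)
  then have "chi (a, 0) v = - 1" by (simp add: chi_def)
  then show thesis by (rule that)
qed

lemma sum_translate:
  fixes L :: "((bit ^ 'n) \<times> (bit ^ 'n)) set"
  assumes "\<And>p. p \<in> L \<Longrightarrow> p + q \<in> M" "\<And>p. p \<in> M \<Longrightarrow> p + q \<in> L"
  shows "(\<Sum>p\<in>L. f (p + q)) = (\<Sum>p\<in>M. f p)"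
  by (rule sum.reindex_bij_witness[where i = "\<lambda>p. p + q" and j = "\<lambda>p. p + q"])
    (use assms in \<open>auto simp: add.assoc\<close>)

definition subgp :: "((bit ^ 'n) \<times> (bit ^ 'n)) set \<Rightarrow> bool" where
  "subgp L \<longleftrightarrow> 0 \<in> L \<and> (\<forall>p\<in>L. \<forall>q\<in>L. p + q \<in> L)"

text \<open>Translation by an element of \<open>L\<close> at which the character is -1 changes the sign of the sum.\<close>

lemma sum_chi_subgp:
  assumes "subgp L"
  shows "(\<Sum>p\<in>L. chi p v) = (if \<forall>p\<in>L. chi p v = 1 then int (card L) else 0)"
proof (cases "\<forall>p\<in>L. chi p v = 1")
  case False
  then obtain q where q: "q \<in> L" "chi q v = - 1" using chi_cases by blast
  have "(\<Sum>p\<in>L. chi (p + q) v) = (\<Sum>p\<in>L. chi p v)"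
    using assms q by (intro sum_translate) (auto simp: subgp_def)
  then have "(\<Sum>p\<in>L. chi p v) = 0"
    using q by (simp add: chi_add_left sum_negf)
  then show ?thesis by (simp only: False if_False)
qed simp

lemma sum_chi:
  fixes v :: "(bit ^ 'n) \<times> (bit ^ 'n)"
  shows "(\<Sum>p\<in>UNIV. chi p v) = (if v = 0 then (2 ^ CARD('n))\<^sup>2 else 0)"
proof -
  have "subgp (UNIV :: ((bit ^ 'n) \<times> (bit ^ 'n)) set)" by (simp add: subgp_def)
  note * = sum_chi_subgp[OF this, of v]
  show ?thesis
  proof (cases "v = 0")
    case True
    then show ?thesis by (simp add: power2_eq_square)
  next
    case False
    then obtain p where "chi p v = - 1" by (rule chi_nondegenerate)
    then have "\<not> (\<forall>p\<in>UNIV. chi p v = 1)" by (metis UNIV_I one_neq_neg_one)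
    then show ?thesis using * False by simp
  qed
qed

lemma parseval:
  fixes h :: "(bit ^ 'n) \<times> (bit ^ 'n) \<Rightarrow> int"
  shows "(\<Sum>v\<in>UNIV. (\<Sum>p\<in>L. h p * chi p v)\<^sup>2) = (2 ^ CARD('n))\<^sup>2 * (\<Sum>p\<in>L. (h p)\<^sup>2)"
proof -
  have "(\<Sum>v\<in>UNIV. (\<Sum>p\<in>L. h p * chi p v)\<^sup>2)
      = (\<Sum>v\<in>UNIV. \<Sum>p\<in>L. \<Sum>q\<in>L. h p * h q * chi (p + q) v)"
    by (simp add: power2_eq_square sum_product chi_add_left mult_ac)
  also have "\<dots> = (\<Sum>p\<in>L. \<Sum>q\<in>L. h p * h q * (\<Sum>v\<in>UNIV. chi v (p + q)))"
    by (subst sum.swap, rule sum.cong[OF refl], subst sum.swap)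
      (simp add: sum_distrib_left chi_commute[of _ "_ + _"])
  also have "\<dots> = (\<Sum>p\<in>L. \<Sum>q\<in>L. if q = p then h p * h q * (2 ^ CARD('n))\<^sup>2 else 0)"
    by (intro sum.cong refl) (auto simp: sum_chi)
  also have "\<dots> = (2 ^ CARD('n))\<^sup>2 * (\<Sum>p\<in>L. (h p)\<^sup>2)"
    by (simp add: sum_distrib_left power2_eq_square mult_ac)
  finally show ?thesis .
qed

text \<open>The number of ways to write \<open>v\<close> as an ordered sum of \<open>k\<close> elements of \<open>A\<close>, that is, the
  \<open>k\<close>-th convolution power of the indicator function of \<open>A\<close>; its values are the moments of
  the Fourier transform \<open>psi A\<close> below.\<close>

primrec rep :: "((bit ^ 'n) \<times> (bit ^ 'n)) set \<Rightarrow> nat \<Rightarrow> (bit ^ 'n) \<times> (bit ^ 'n) \<Rightarrow> int" where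
  "rep A 0 v = of_bool (v = 0)"
| "rep A (Suc k) v = (\<Sum>t\<in>A. rep A k (v + t))"

definition psi :: "((bit ^ 'n) \<times> (bit ^ 'n)) set \<Rightarrow> (bit ^ 'n) \<times> (bit ^ 'n) \<Rightarrow> int" where
  "psi A p = (\<Sum>t\<in>A. chi p t)"

lemma psi_moment:
  fixes A :: "((bit ^ 'n) \<times> (bit ^ 'n)) set"
  shows "(\<Sum>p\<in>UNIV. psi A p ^ k * chi p v) = (2 ^ CARD('n))\<^sup>2 * rep A k v"
proof (induction k arbitrary: v)
  case 0
  then show ?case by (simp add: sum_chi)
next
  case (Suc k)
  have "(\<Sum>p\<in>UNIV. psi A p ^ Suc k * chi p v)
      = (\<Sum>p\<in>UNIV. \<Sum>t\<in>A. psi A p ^ k * chi p (v + t))"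
    by (simp add: psi_def sum_distrib_left sum_distrib_right chi_add_right mult_ac)
  also have "\<dots> = (\<Sum>t\<in>A. \<Sum>p\<in>UNIV. psi A p ^ k * chi p (v + t))"
    by (rule sum.swap)
  finally show ?case by (simp add: Suc.IH sum_distrib_left)
qed

lemma psi_square_sum:
  "(\<Sum>p\<in>L. (psi A p)\<^sup>2 * chi p v) = (\<Sum>s\<in>A. \<Sum>t\<in>A. \<Sum>p\<in>L. chi p (v + s + t))"
proof -
  have "(\<Sum>p\<in>L. (psi A p)\<^sup>2 * chi p v) = (\<Sum>p\<in>L. \<Sum>s\<in>A. \<Sum>t\<in>A. chi p (v + s + t))"
  proof (rule sum.cong[OF refl])
    fix p
    have "(psi A p)\<^sup>2 = (\<Sum>s\<in>A. \<Sum>t\<in>A. chi p s * chi p t)"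
      by (simp only: psi_def power2_eq_square sum_product)
    then show "(psi A p)\<^sup>2 * chi p v = (\<Sum>s\<in>A. \<Sum>t\<in>A. chi p (v + s + t))"
      by (simp only: sum_distrib_right chi_add_right) (simp add: mult_ac)
  qed
  also have "\<dots> = (\<Sum>s\<in>A. \<Sum>t\<in>A. \<Sum>p\<in>L. chi p (v + s + t))"
    by (subst sum.swap, rule sum.cong[OF refl], rule sum.swap)
  finally show ?thesis .
qed

lemma rep_1: "rep A (Suc 0) v = of_bool (v \<in> A)"
  by (simp add: of_bool_def if_distrib sum.delta' eq_commute[of v] cong: if_cong)

lemma rep_2: "rep A 2 v = int (card {t \<in> A. v + t \<in> A})"
  unfolding numeral_2_eq_2 rep.simps(2)[of A "Suc 0"] by (simp only: rep_1) (simp add: Int_def)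

lemma rep_3: "rep A 3 v = (\<Sum>t\<in>A. rep A 2 (v + t))"
  by (simp add: numeral_3_eq_3 numeral_2_eq_2)

lemma rep_4: "rep A 4 v = (\<Sum>s\<in>A. \<Sum>t\<in>A. rep A 2 (v + s + t))"
proof -
  have "4 = Suc (Suc 2)" by simp
  then show ?thesis by (simp only: rep.simps(2))
qed

lemma rep_2_0: "rep A 2 0 = int (card A)"
  by (simp add: rep_2)

lemma rep_nonneg: "0 \<le> rep A k v"
  by (induction k arbitrary: v) (auto intro: sum_nonneg)

section \<open>Sidon sets\<close>

text \<open>In characteristic 2 the usual condition on \<open>r + s = t + u\<close> is symmetric in the four
  points.\<close>

definition sidon :: "((bit ^ 'n) \<times> (bit ^ 'n)) set \<Rightarrow> bool" where
  "sidon A \<longleftrightarrow> (\<forall>r\<in>A. \<forall>s\<in>A. \<forall>t\<in>A. \<forall>u\<in>A.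
     r + s + t + u = 0 \<longrightarrow> r = s \<or> r = t \<or> r = u)"

lemma sidonD:
  assumes "sidon A" "r \<in> A" "s \<in> A" "t \<in> A" "u \<in> A" "r + s = t + u"
  shows "r = s \<or> r = t \<or> r = u"
proof -
  have "r + s + t + u = 0" using assms(6) by (simp add: add.assoc)
  then show ?thesis using assms unfolding sidon_def by blast
qed

lemma sidon_rep_2_diff:
  assumes "sidon A" "s \<in> A" "t \<in> A" "s \<noteq> t"
  shows "rep A 2 (s + t) = 2"
proof -
  have "u = s \<or> u = t" if "u \<in> A" "s + t + u \<in> A" for u
  proof -
    have "s + t = u + (s + t + u)" by (simp add: add.commute[of "s + t" u])
    from sidonD[OF assms(1-3) that this] show ?thesis
      using assms(4) by (auto simp: add.commute[of _ u] pair_add_eq_iff)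
  qed
  moreover have "s + t + t = s" "s + t + s = t" by (simp_all add: add.commute[of s] add.assoc)
  ultimately have "{u \<in> A. s + t + u \<in> A} = {s, t}"
    using assms(2,3) unfolding set_eq_iff mem_Collect_eq insert_iff empty_iff by metis
  then show ?thesis using assms(4) by (simp add: rep_2)
qed

lemma sidon_rep_2:
  assumes "sidon A" "v \<noteq> 0"
  shows "rep A 2 v = 0 \<or> rep A 2 v = 2"
proof (cases "\<exists>t\<in>A. v + t \<in> A")
  case True
  then obtain t where t: "t \<in> A" "v + t \<in> A" by blast
  then have "rep A 2 ((v + t) + t) = 2" using assms by (intro sidon_rep_2_diff) auto
  then show ?thesis by (simp add: add.assoc)
qed (auto simp: rep_2)

lemma sum_rep_2_diff:
  assumes "sidon A" "s \<in> A"
  shows "(\<Sum>t\<in>A. rep A 2 (s + t)) = 3 * int (card A) - 2"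
proof -
  have "(\<Sum>t\<in>A. rep A 2 (s + t)) = rep A 2 (s + s) + (\<Sum>t\<in>A - {s}. rep A 2 (s + t))"
    using assms by (simp add: sum.remove)
  also have "(\<Sum>t\<in>A - {s}. rep A 2 (s + t)) = (\<Sum>t\<in>A - {s}. 2)"
    using assms by (intro sum.cong refl sidon_rep_2_diff) auto
  also have "\<dots> = 2 * (int (card A) - 1)"
    using assms card_gt_0_iff[of A] by (auto simp: of_nat_diff Suc_leI)
  finally show ?thesis by (simp add: rep_2_0)
qed

text \<open>Four points of \<open>A\<close> with sum 0 coincide in pairs, so the number of such quadruples depends
  on the cardinality alone. This is the fourth moment of \<open>psi A\<close>.\<close>

lemma rep_4_sidon:
  assumes "sidon A"
  shows "rep A 4 0 = int (card A) * (3 * int (card A) - 2)"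
  using assms by (simp add: rep_4 sum_rep_2_diff)

lemma rep_3_member:
  assumes "sidon A" "v \<in> A"
  shows "rep A 3 v = 3 * int (card A) - 2"
  using assms by (simp add: rep_3 sum_rep_2_diff)

lemma rep_3_even:
  assumes "sidon A" "v \<notin> A"
  shows "2 dvd rep A 3 v"
  unfolding rep_3
proof (rule dvd_sum)
  fix t assume "t \<in> A"
  then have "v + t \<noteq> 0" using assms by auto
  then show "2 dvd rep A 2 (v + t)" using sidon_rep_2[OF assms(1)] by fastforce
qed

lemma rep_3_le:
  assumes "sidon A" "v \<notin> A"
  shows "rep A 3 v \<le> 2 * int (card A)"
proof -
  have "rep A 3 v \<le> (\<Sum>t\<in>A. 2)"
    unfolding rep_3
  proof (rule sum_mono)
    fix t assume "t \<in> A"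
    then have "v + t \<noteq> 0" using assms by auto
    then show "rep A 2 (v + t) \<le> 2" using sidon_rep_2[OF assms(1)] by fastforce
  qed
  then show ?thesis by simp
qed

text \<open>The orbits of \<open>\<rho>\<close> partition \<open>X\<close> into sets of three elements.\<close>

lemma three_dvd_card:
  assumes fin: "finite X" and closed: "\<And>x. x \<in> X \<Longrightarrow> \<rho> x \<in> X"
    and order3: "\<And>x. x \<in> X \<Longrightarrow> \<rho> (\<rho> (\<rho> x)) = x" and free: "\<And>x. x \<in> X \<Longrightarrow> \<rho> x \<noteq> x"
  shows "3 dvd card X"
proof -
  define orb where "orb = (\<lambda>x. {x, \<rho> x, \<rho> (\<rho> x)})"
  have orb_eq: "orb y = orb x" if "x \<in> X" "y \<in> orb x" for x y
    using that order3[OF that(1)] by (auto simp: orb_def)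
  have "3 dvd card c" if "c \<in> orb ` X" for c
  proof -
    obtain x where x: "x \<in> X" "c = orb x" using \<open>c \<in> orb ` X\<close> by auto
    have "\<rho> x \<noteq> x" "\<rho> (\<rho> x) \<noteq> \<rho> x"
      using free[OF x(1)] free[OF closed[OF x(1)]] by simp_all
    moreover have "\<rho> (\<rho> x) \<noteq> x" using calculation(1) order3[OF x(1)] by metis
    ultimately have "\<rho> x \<noteq> x" "\<rho> (\<rho> x) \<noteq> \<rho> x" "\<rho> (\<rho> x) \<noteq> x" by simp_all
    then have "card c = 3" unfolding x(2) orb_def by simp
    then show ?thesis by simp
  qed
  moreover have "c1 \<inter> c2 = {}" if "c1 \<in> orb ` X" "c2 \<in> orb ` X" "c1 \<noteq> c2" for c1 c2
  proof (rule ccontr)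
    assume "c1 \<inter> c2 \<noteq> {}"
    then obtain y where "y \<in> c1" "y \<in> c2" by blast
    then show False using that orb_eq by (metis imageE)
  qed
  moreover have "\<Union> (orb ` X) = X" using closed by (auto simp: orb_def)
  ultimately show ?thesis using dvd_partition[of "orb ` X" 3] fin by metis
qed

text \<open>The cyclic shift acts on the triples with sum \<open>v\<close>. A fixed triple would be constant, with
  \<open>v\<close> equal to its entry.\<close>

lemma rep_3_dvd_3:
  assumes "v \<notin> A"
  shows "3 dvd rep A 3 v"
proof -
  define X where "X = {(r, s). r \<in> A \<and> s \<in> A \<and> v + r + s \<in> A}"
  have "X = (SIGMA r:A. {s \<in> A. v + r + s \<in> A})" by (auto simp: X_def)
  then have "rep A 3 v = int (card X)" by (simp add: rep_3 rep_2 flip: of_nat_sum)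
  moreover have "3 dvd card X"
  proof (rule three_dvd_card[where \<rho> = "\<lambda>(r, s). (s, v + r + s)"])
    fix x assume "x \<in> X"
    then obtain r s where rs: "x = (r, s)" "r \<in> A" "s \<in> A" "v + r + s \<in> A"
      by (auto simp only: X_def)
    have "v + s + (v + r + s) = r" by (simp add: ac_simps)
    then have "v + s + (v + r + s) \<in> A" using rs(2) by (simp only:)
    then show "(case x of (r, s) \<Rightarrow> (s, v + r + s)) \<in> X"
      using rs unfolding X_def by simp
  next
    fix x assume "x \<in> X"
    then obtain r s where rs: "x = (r, s)" "r \<in> A" "s \<in> A" "v + r + s \<in> A"
      by (auto simp only: X_def)
    have "v + s + (v + r + s) = r" "v + (v + r + s) + r = s" by (simp_all add: ac_simps)
    then show "(case case case x of (r, s) \<Rightarrow> (s, v + r + s) of (r, s) \<Rightarrow> (s, v + r + s)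
        of (r, s) \<Rightarrow> (s, v + r + s)) = x" by (simp only: rs prod.case)
    have "\<not> (s = r \<and> v + r + s = s)"
    proof
      assume "s = r \<and> v + r + s = s"
      then have "v = r" by simp
      then show False using assms rs(2) by simp
    qed
    then show "(case x of (r, s) \<Rightarrow> (s, v + r + s)) \<noteq> x" by (simp only: rs prod.case prod.inject) blast
  qed simp
  ultimately show ?thesis by (metis int_dvd_int_iff of_nat_numeral)
qed

lemma chi_sum_eq:
  assumes "finite A"
  shows "chi p (\<Sum>A) = (- 1) ^ card {t \<in> A. chi p t = - 1}"
  using assms
proof (induction A rule: finite_induct)
  case (insert t A)
  show ?case
  proof (cases "chi p t = - 1")
    case True
    then have "{u \<in> insert t A. chi p u = - 1} = insert t {u \<in> A. chi p u = - 1}" by auto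
    then show ?thesis using insert True by (simp add: chi_add_right)
  next
    case False
    then have "{u \<in> insert t A. chi p u = - 1} = {u \<in> A. chi p u = - 1}" by auto
    then show ?thesis using insert False chi_cases[of p t] by (simp add: chi_add_right)
  qed
qed simp

lemma psi_eq:
  "psi A p = int (card A) - 2 * int (card {t \<in> A. chi p t = - 1})"
proof -
  have "psi A p = (\<Sum>t\<in>A. 1 - 2 * of_bool (chi p t = - 1))"
    unfolding psi_def
  proof (rule sum.cong[OF refl])
    fix t show "chi p t = 1 - 2 * of_bool (chi p t = - 1)"
      using chi_cases[of p t] by auto
  qed
  also have "\<dots> = int (card A) - 2 * (\<Sum>t\<in>A. of_bool (chi p t = - 1))"
    by (simp add: sum_subtractf flip: sum_distrib_left)
  also have "(\<Sum>t\<in>A. of_bool (chi p t = - 1)) = int (card {t \<in> A. chi p t = - 1})"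
    by (simp add: Int_def)
  finally show ?thesis .
qed

text \<open>Let \<open>x\<close> be the number of points of \<open>A\<close> at which the character is -1. Then \<open>psi\<close> is
  \<open>card A - 2 * x\<close>, while the parity of \<open>x\<close> is read off from the character at the sum of all
  points.\<close>

lemma psi_mod_4:
  shows "chi p (\<Sum>A) = 1 \<Longrightarrow> 4 dvd psi A p - int (card A)"
    and "chi p (\<Sum>A) = - 1 \<Longrightarrow> 4 dvd psi A p - int (card A) + 2"
proof -
  let ?x = "card {t \<in> A. chi p t = - 1}"
  note * = chi_sum_eq[of A p] psi_eq[of A p]
  show "4 dvd psi A p - int (card A)" if "chi p (\<Sum>A) = 1"
  proof -
    have "even ?x" using * that by (cases "even ?x") auto
    then obtain k where "?x = 2 * k" by blast
    then show ?thesis using *(2) by simp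
  qed
  show "4 dvd psi A p - int (card A) + 2" if "chi p (\<Sum>A) = - 1"
  proof -
    have "odd ?x" using * that by (cases "even ?x") auto
    then obtain k where "?x = 2 * k + 1" by (rule oddE)
    then show ?thesis using *(2) by simp
  qed
qed

text \<open>The sum over a coset of \<open>{0, p, q, p + q}\<close> kills every point except those on which \<open>p\<close> and
  \<open>q\<close> are trivial, and these contribute 4 or -4 each. Modulo 8 the result is thus
  independent of \<open>c\<close>: this is what makes residues of \<open>psi\<close> quadratic functions of the
  character.\<close>

lemma psi_four_term:
  "\<exists>z. psi A c + psi A (c + p) + psi A (c + q) + psi A (c + p + q)
     = 4 * int (card {t \<in> A. chi p t = 1 \<and> chi q t = 1}) + 8 * z"
proof -
  let ?M = "{t \<in> A. chi p t = 1 \<and> chi q t = 1}"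
  have "psi A c + psi A (c + p) + psi A (c + q) + psi A (c + p + q)
      = (\<Sum>t\<in>A. chi c t * (1 + chi p t) * (1 + chi q t))"
    by (simp add: psi_def chi_add_left algebra_simps sum.distrib)
  also have "\<dots> = (\<Sum>t\<in>?M. chi c t * (1 + chi p t) * (1 + chi q t))"
  proof (rule sum.mono_neutral_right)
    show "\<forall>t\<in>A - ?M. chi c t * (1 + chi p t) * (1 + chi q t) = 0"
      using chi_cases[of p] chi_cases[of q] by fastforce
  qed auto
  also have "\<dots> = 4 * psi ?M c"
    by (simp add: psi_def sum_distrib_left)
  finally show ?thesis
    by (intro exI[of _ "- int (card {t \<in> ?M. chi c t = - 1})"]) (simp add: psi_eq[of ?M])
qed

section \<open>Sidon graphs in a hyperplane\<close>

text \<open>No multiple of \<open>c\<close> lies strictly between \<open>-c\<close> and 0. All lower bounds on character sums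
  below rest on this: a polynomial with roots at consecutive members of a residue class is
  nonnegative on the class.\<close>

lemma consecutive_nonneg:
  fixes x c :: int
  assumes "c dvd x"
  shows "0 \<le> x * (x + c)"
proof -
  obtain k where k: "x = c * k" using assms by (rule dvdE)
  have "0 \<le> k * (k + 1)" by (cases "0 \<le> k") (auto simp: mult_nonpos_nonpos)
  then have "0 \<le> c\<^sup>2 * (k * (k + 1))" by simp
  also have "\<dots> = x * (x + c)" by (simp add: k power2_eq_square algebra_simps)
  finally show ?thesis .
qed

lemma quartic_nonneg:
  fixes y k c :: int
  assumes "c dvd y - k" "c dvd y + k"
  shows "0 \<le> (y\<^sup>2 - k\<^sup>2) * (y\<^sup>2 - (k + c)\<^sup>2)"
proof -
  have "c dvd y - k - c" using assms(1) by simp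
  from mult_nonneg_nonneg[OF consecutive_nonneg[OF this] consecutive_nonneg[OF assms(2)]]
  show ?thesis by (simp add: power2_eq_square algebra_simps)
qed

text \<open>A nonzero linear functional is 1 at half of all points, and for dimension at least 2 this
  is an even number.\<close>

lemma sum_UNIV_bit_vec:
  assumes "2 \<le> CARD('n)"
  shows "(\<Sum>x\<in>UNIV. x) = (0 :: bit ^ 'n)"
proof (rule ccontr)
  let ?X = "UNIV \<times> {0} :: ((bit ^ 'n) \<times> (bit ^ 'n)) set"
  assume "(\<Sum>x\<in>UNIV. x) \<noteq> (0 :: bit ^ 'n)"
  then obtain u :: "bit ^ 'n" where u: "bdot u (\<Sum>x\<in>UNIV. x) = 1"
    by (rule bdot_nondegenerate)
  have "u \<noteq> 0" using u by auto
  then obtain y where y: "bdot y u = 1" by (rule bdot_nondegenerate)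
  have "(\<Sum>p\<in>?X. chi p (u, 0)) = 0"
    using y by (subst sum_chi_subgp) (auto simp: subgp_def chi_def zero_prod_def intro!: bexI[of _ "(y, 0)"])
  then have psi0: "psi ?X (u, 0) = 0" by (simp add: psi_def chi_commute)
  have sumX: "\<Sum>?X = ((\<Sum>x\<in>UNIV. x), 0)"
  proof -
    have "\<Sum>?X = (\<Sum>x\<in>UNIV. (x, 0))"
      by (rule sum.reindex_bij_witness[where i = "\<lambda>x. (x, 0)" and j = fst]) auto
    then show ?thesis by (simp add: prod_eq_iff fst_sum snd_sum)
  qed
  have "chi (u, 0) (\<Sum>?X) = - 1" using u by (simp only: sumX) (simp add: chi_def)
  from psi_mod_4(2)[OF this] have "4 dvd 2 - int (card ?X)" using psi0 by simp
  moreover have "4 dvd int (card ?X)"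
    using assms le_imp_power_dvd[of 2 "CARD('n)" "2 :: int"] by (simp add: card_cartesian_product)
  ultimately have "4 dvd (2 :: int)" by (metis dvd_diff diff_add_cancel dvd_add)
  then show False by simp
qed

text \<open>The graph of a function defined on \<open>fst ` A\<close>, with values in the hyperplane orthogonal to
  \<open>b\<close>. Because of the hyperplane, \<open>psi A\<close> is invariant under translation by \<open>(0, b)\<close>.\<close>

locale sidon_graph =
  fixes A :: "((bit ^ 'n) \<times> (bit ^ 'n)) set" and b :: "bit ^ 'n" and N a :: int
  assumes inj: "inj_on fst A" and sidon: "sidon A" and b: "b \<noteq> 0"
    and hyp: "\<And>t. t \<in> A \<Longrightarrow> bdot b (snd t) = 0"
    and N: "N = 2 ^ CARD('n)" and a: "a = int (card A)"
begin

text \<open>On these characters \<open>psi A\<close> only sees the projection \<open>fst ` A\<close>, which is almost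
  everything; its values there are exceptional and are treated separately in every sum over
  characters.\<close>

definition bad :: "((bit ^ 'n) \<times> (bit ^ 'n)) set" where
  "bad = {p. snd p = 0 \<or> snd p = b}"

abbreviation \<sigma> where "\<sigma> \<equiv> \<Sum>A"

lemma N_pos: "0 < N"
  by (simp add: N)

lemma psi_0: "psi A 0 = a"
  by (simp add: psi_def a)

lemma chi_0b: "bdot b (snd v) = 0 \<Longrightarrow> chi (0, b) v = 1"
  by (simp add: chi_def)

lemma psi_shift: "psi A (p + (0, b)) = psi A p"
  unfolding psi_def by (intro sum.cong refl) (simp add: chi_add_left chi_0b hyp)

lemma hyp_add: "bdot b (snd v) = 0 \<Longrightarrow> bdot b (snd w) = 0 \<Longrightarrow> bdot b (snd (v + w)) = 0"
  by (simp add: bdot_add_right)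

lemma hyp_sigma: "bdot b (snd \<sigma>) = 0"
proof -
  have "chi (0, b) \<sigma> = 1"
  proof -
    have "{t \<in> A. chi (0, b) t = - 1} = {}" using chi_0b hyp by force
    then show ?thesis by (simp only: chi_sum_eq[OF finite]) simp
  qed
  then show ?thesis by (cases "bdot b (snd \<sigma>)") (auto simp: chi_def)
qed

lemma subgp_bad: "subgp bad"
  by (auto simp: subgp_def bad_def)

lemma card_bad: "int (card bad) = 2 * N"
proof -
  have "bad = UNIV \<times> {0, b}" by (auto simp: bad_def)
  then show ?thesis using b by (simp add: card_cartesian_product N)
qed

lemma sum_chi_bad:
  assumes "bdot b (snd v) = 0"
  shows "(\<Sum>p\<in>bad. chi p v) = (if fst v = 0 then 2 * N else 0)"
proof (cases "fst v = 0")
  case True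
  then have "\<forall>p\<in>bad. chi p v = 1" using assms by (auto simp: bad_def chi_def)
  then show ?thesis using sum_chi_subgp[OF subgp_bad, of v] True by (simp add: card_bad)
next
  case False
  then obtain y where "bdot y (fst v) = 1" by (rule bdot_nondegenerate)
  then have "(y, 0) \<in> bad" "chi (y, 0) v \<noteq> 1" by (auto simp: bad_def chi_def)
  then show ?thesis using sum_chi_subgp[OF subgp_bad, of v] False by auto
qed

lemma sum_psi_bad:
  assumes "bdot b (snd v) = 0"
  shows "(\<Sum>p\<in>bad. psi A p * chi p v) = 2 * N * of_bool (fst v \<in> fst ` A)"
proof -
  have "(\<Sum>p\<in>bad. psi A p * chi p v) = (\<Sum>t\<in>A. \<Sum>p\<in>bad. chi p (t + v))"
    by (subst sum.swap) (simp add: psi_def sum_distrib_right chi_add_right)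
  also have "\<dots> = (\<Sum>t\<in>A. 2 * N * of_bool (fst t = fst v))"
    using assms hyp by (intro sum.cong refl) (simp add: sum_chi_bad bdot_add_right)
  also have "\<dots> = 2 * N * of_bool (fst v \<in> fst ` A)"
  proof (cases "fst v \<in> fst ` A")
    case True
    then obtain t where t: "t \<in> A" "fst t = fst v" by auto
    then have "{u \<in> A. fst u = fst v} = {t}" using inj by (auto simp: inj_on_def)
    then show ?thesis using True by (simp add: Int_def flip: sum_distrib_left)
  next
    case False
    then have "fst t \<noteq> fst v" if "t \<in> A" for t using that by (metis imageI)
    then show ?thesis using False by simp
  qed
  finally show ?thesis .
qed

lemma sum_psi_square_bad: "(\<Sum>p\<in>bad. (psi A p)\<^sup>2) = 2 * N * a"
proof -
  have "(\<Sum>p\<in>bad. (psi A p)\<^sup>2) = (\<Sum>s\<in>A. \<Sum>t\<in>A. \<Sum>p\<in>bad. chi p (s + t))"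
    using psi_square_sum[where L = bad and v = 0] by simp
  also have "\<dots> = (\<Sum>s\<in>A. \<Sum>t\<in>A. if t = s then 2 * N else 0)"
    using hyp inj by (intro sum.cong refl) (auto simp: sum_chi_bad bdot_add_right inj_on_def)
  also have "\<dots> = 2 * N * a" by (simp add: a)
  finally show ?thesis .
qed

lemma card_compl: "int (card (- fst ` A)) = N - a"
proof -
  have "card (- fst ` A) = card (UNIV :: (bit ^ 'n) set) - card A"
    by (simp add: Compl_eq_Diff_UNIV card_Diff_subset card_image[OF inj])
  moreover have "card A \<le> card (UNIV :: (bit ^ 'n) set)"
    using card_mono[of UNIV "fst ` A"] by (simp add: card_image[OF inj])
  ultimately show ?thesis by (simp add: a N of_nat_diff)
qed

text \<open>A nontrivial character of the first coordinate sums to 0 over the whole space, so \<open>psi\<close> is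
  minus its sum over the first coordinates missing from the graph.\<close>

lemma psi_bad_le:
  assumes "p \<in> bad" "fst p \<noteq> 0"
  shows "\<bar>psi A p\<bar> \<le> N - a"
proof -
  define f where "f x = chi p (x, 0)" for x
  have "chi p t = f (fst t)" if "t \<in> A" for t
    using hyp[OF that] assms(1) by (auto simp: f_def chi_def bad_def)
  then have 1: "psi A p = (\<Sum>x\<in>fst ` A. f x)"
    by (simp add: psi_def sum.reindex[OF inj])
  obtain y where y: "bdot y (fst p) = 1" using assms(2) by (rule bdot_nondegenerate)
  have "(\<Sum>x\<in>UNIV. f (x + y)) = (\<Sum>x\<in>UNIV. f x)"
    by (rule sum.reindex_bij_witness[where i = "\<lambda>x. x + y" and j = "\<lambda>x. x + y"])
      (auto simp: add.assoc)
  moreover have "f (x + y) = - f x" for x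
    using chi_add_right[of p "(x, 0)" "(y, 0)"] y
    by (simp add: f_def chi_def[of p "(y, 0)"] bdot_commute)
  ultimately have "(\<Sum>x\<in>UNIV. f x) = 0" by (simp add: sum_negf)
  moreover have "(\<Sum>x\<in>UNIV. f x) = (\<Sum>x\<in>fst ` A. f x) + (\<Sum>x\<in>- fst ` A. f x)"
    by (subst sum.union_disjoint[symmetric]) auto
  ultimately have "psi A p = - (\<Sum>x\<in>- fst ` A. f x)" using 1 by simp
  also have "\<bar>\<dots>\<bar> \<le> (\<Sum>x\<in>- fst ` A. \<bar>f x\<bar>)" by simp
  also have "\<dots> \<le> (\<Sum>x\<in>- fst ` A. 1)"
    using chi_cases[of p] by (intro sum_mono) (auto simp: f_def, metis abs_minus abs_one order_refl)
  finally show ?thesis by (simp add: card_compl)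
qed

lemma bad_0: "{p \<in> bad. fst p = 0} = {0, (0, b)}"
  by (auto simp: bad_def prod_eq_iff)

lemma fst_sigma:
  assumes "2 \<le> CARD('n)"
  shows "fst \<sigma> = \<Sum>(- fst ` A)"
proof -
  have "(\<Sum>x\<in>UNIV. x) = \<Sum>(fst ` A) + \<Sum>(- fst ` A)"
    by (subst sum.union_disjoint[symmetric]) auto
  then have "\<Sum>(fst ` A) = \<Sum>(- fst ` A)" using sum_UNIV_bit_vec[OF assms] by simp
  then show ?thesis by (simp add: fst_sum sum.reindex[OF inj])
qed

lemma psi_moments:
  shows "(\<Sum>p\<in>UNIV. psi A p * chi p v) = N\<^sup>2 * of_bool (v \<in> A)"
    and "(\<Sum>p\<in>UNIV. (psi A p)\<^sup>2 * chi p v) = N\<^sup>2 * rep A 2 v"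
    and "(\<Sum>p\<in>UNIV. (psi A p) ^ 3 * chi p v) = N\<^sup>2 * rep A 3 v"
    and "(\<Sum>p\<in>UNIV. (psi A p)\<^sup>2) = N\<^sup>2 * a"
    and "(\<Sum>p\<in>UNIV. (psi A p) ^ 4) = N\<^sup>2 * (a * (3 * a - 2))"
    and "int (card (UNIV :: ((bit ^ 'n) \<times> (bit ^ 'n)) set)) = N\<^sup>2"
  using psi_moment[of A 1 v] psi_moment[of A 2 v] psi_moment[of A 3 v] psi_moment[of A 2 0]
    psi_moment[of A 4 0]
  by (simp_all add: N a rep_1 rep_2_0 rep_4_sidon[OF sidon] power2_eq_square del: rep.simps)

lemma sum_chi_UNIV: "(\<Sum>p\<in>UNIV. chi p (v :: (bit ^ 'n) \<times> (bit ^ 'n))) = (if v = 0 then N\<^sup>2 else 0)"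
  by (simp add: sum_chi N)

lemma sum_split_bad: "(\<Sum>p\<in>UNIV. f p) = (\<Sum>p\<in>- bad. f p) + (\<Sum>p\<in>bad. (f p :: int))"
  using sum.union_disjoint[of "- bad" bad f] by simp

lemma sum_split_bad_0: "(\<Sum>p\<in>bad. f p) = f 0 + f (0, b) + (\<Sum>p\<in>{p \<in> bad. fst p \<noteq> 0}. (f p :: int))"
proof -
  have "(\<Sum>p\<in>bad. f p) = (\<Sum>p\<in>{p \<in> bad. fst p = 0}. f p) + (\<Sum>p\<in>{p \<in> bad. fst p \<noteq> 0}. f p)"
    by (subst sum.union_disjoint[symmetric]) (auto intro!: sum.cong)
  moreover have "(0 :: (bit ^ 'n) \<times> (bit ^ 'n)) \<noteq> (0, b)" using b by (auto simp: prod_eq_iff)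
  ultimately show ?thesis by (simp add: bad_0)
qed

end

lemma power5_eq: "(z :: int) ^ 5 = z * z * z * z * z"
  by (simp add: eval_nat_numeral)

section \<open>Two missing points in odd dimension\<close>

definition quartic :: "int \<Rightarrow> int \<Rightarrow> int" where
  "quartic k y = (y\<^sup>2 - k\<^sup>2) * (y\<^sup>2 - (k + 4)\<^sup>2)"

text \<open>The left side bounds a sum of quartics over all characters, the right side is its part on
  the bad ones. Here \<open>2 * q + r\<close> and \<open>2 * q - r\<close> are the distances of \<open>N\<close> from \<open>(q - 1)\<^sup>2\<close>
  and \<open>(q + 1)\<^sup>2\<close>. In terms of \<open>x\<close> and \<open>y\<close>, by which they exceed their lower bounds, the
  difference of the two sides is a polynomial with positive coefficients.\<close>

lemma moment_balance_1:
  fixes q r N a :: int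
  assumes N: "N = q\<^sup>2 + 1 + r" and a: "a = N - 2" and "4 \<le> 2 * q + r" "4 \<le> 2 * q - r"
  shows "N\<^sup>2 * (2 * (a * (3 * a - 2)) - ((q - 3)\<^sup>2 + (q + 1)\<^sup>2 + (q - 1)\<^sup>2 + (q + 3)\<^sup>2) * a
      + 16 * q + ((q - 3)\<^sup>2 * (q + 1)\<^sup>2 + (q - 1)\<^sup>2 * (q + 3)\<^sup>2))
    < 4 * quartic (q - 3) a + (2 * N - 4) * quartic (q - 3) 2 + 2 * N * quartic (q - 1) 0"
    (is "?L < ?R")
proof -
  define x y where "x = 2 * q + r - 4" and "y = 2 * q - r - 4"
  have "128 * (?R - ?L) =
       20480 + 54784 * x + 23296 * x * y + 4544 * x * y ^ 2 + 512 * x * y ^ 3 + 30 * x * y ^ 4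
       + 1 * x * y ^ 5 + 27648 * x ^ 2 + 9920 * x ^ 2 * y + 1440 * x ^ 2 * y ^ 2 + 116 * x ^ 2
       * y ^ 3 + 4 * x ^ 2 * y ^ 4 + 4928 * x ^ 3 + 1536 * x ^ 3 * y + 156 * x ^ 3 * y ^ 2 + 6
       * x ^ 3 * y ^ 3 + 304 * x ^ 4 + 74 * x ^ 4 * y + 4 * x ^ 4 * y ^ 2 + 6 * x ^ 5 + 1 * x ^
       5 * y + 14848 * y + 4096 * y ^ 2 + 576 * y ^ 3 + 48 * y ^ 4 + 2 * y ^ 5"
    unfolding quartic_def N a x_def y_def by (simp add: algebra_simps power2_eq_square power3_eq_cube power4_eq_xxxx power5_eq)
  moreover have "0 \<le> x" "0 \<le> y" using assms by (auto simp: x_def y_def)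
  ultimately have "0 < 128 * (?R - ?L)" by (simp only:) (intro add_pos_nonneg mult_nonneg_nonneg zero_le_power; simp)
  then show ?thesis by simp
qed

text \<open>The same with the two residue classes exchanged. Now \<open>N\<close> has to be further away from
  \<open>(q - 1)\<^sup>2\<close>.\<close>

lemma moment_balance_2:
  fixes q r N a :: int
  assumes N: "N = q\<^sup>2 + 1 + r" and a: "a = N - 2" and "12 \<le> 2 * q + r" "4 \<le> 2 * q - r"
  shows "N\<^sup>2 * (2 * (a * (3 * a - 2)) - ((q - 3)\<^sup>2 + (q + 1)\<^sup>2 + (q - 1)\<^sup>2 + (q + 3)\<^sup>2) * a
      + ((q - 3)\<^sup>2 * (q + 1)\<^sup>2 + (q - 1)\<^sup>2 * (q + 3)\<^sup>2))
    < 4 * quartic (q - 1) a + (2 * N - 4) * quartic (q - 1) 2 + 2 * N * quartic (q - 3) 0"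
    (is "?L < ?R")
proof -
  define x y where "x = 2 * q + r - 12" and "y = 2 * q - r - 4"
  have "128 * (?R - ?L) =
       3268608 + 1227776 * x + 470784 * x * y + 51456 * x * y ^ 2 + 2944 * x * y ^ 3 + 84 * x *
       y ^ 4 + 1 * x * y ^ 5 + 174080 * x ^ 2 + 62976 * x ^ 2 * y + 5760 * x ^ 2 * y ^ 2 + 240
       * x ^ 2 * y ^ 3 + 4 * x ^ 2 * y ^ 4 + 11520 * x ^ 3 + 3840 * x ^ 3 * y + 264 * x ^ 3 * y
       ^ 2 + 6 * x ^ 3 * y ^ 3 + 352 * x ^ 4 + 104 * x ^ 4 * y + 4 * x ^ 4 * y ^ 2 + 4 * x ^ 5
       + 1 * x ^ 5 * y + 1308672 * y + 161792 * y ^ 2 + 11264 * y ^ 3 + 416 * y ^ 4 + 8 * y ^ 5"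
    unfolding quartic_def N a x_def y_def by (simp add: algebra_simps power2_eq_square power3_eq_cube power4_eq_xxxx power5_eq)
  moreover have "0 \<le> x" "0 \<le> y" using assms by (auto simp: x_def y_def)
  ultimately have "0 < 128 * (?R - ?L)" by (simp only:) (intro add_pos_nonneg mult_nonneg_nonneg zero_le_power; simp)
  then show ?thesis by simp
qed

lemma square_ne_odd_power_2: "(x :: nat)\<^sup>2 \<noteq> 2 ^ (2 * k + 1)"
proof (induction k arbitrary: x)
  case 0
  show ?case
  proof
    assume "x\<^sup>2 = 2 ^ (2 * 0 + 1)"
    then have "x * x = 2" by (simp add: power2_eq_square)
    moreover from this have "\<not> x \<le> 1" using mult_le_mono[of x 1 x 1] by auto
    then have "2 * 2 \<le> x * x" by (intro mult_le_mono) auto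
    ultimately show False by simp
  qed
next
  case (Suc k)
  show ?case
  proof
    assume eq: "x\<^sup>2 = 2 ^ (2 * Suc k + 1)"
    then have "even (x\<^sup>2)" by simp
    then obtain y where "x = 2 * y" by auto
    then have "y\<^sup>2 = 2 ^ (2 * k + 1)" using eq by (simp add: power_mult_distrib)
    then show False using Suc.IH by blast
  qed
qed

text \<open>The even numbers around the square root of \<open>N\<close> are \<open>q - 1\<close> and \<open>q + 1\<close>. Since \<open>N\<close> is not a
  square and 4 divides \<open>N\<close> and both squares, the distances are at least 4. If 4 divides
  \<open>q - 3\<close>, then \<open>(q - 1)\<^sup>2\<close> is 4 modulo 16 while 16 divides \<open>N\<close>, and the first distance is
  at least 12.\<close>

lemma odd_between_squares:
  fixes N :: int
  assumes "N = 2 ^ n" "odd n" "5 \<le> n"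
  obtains q r where "N = q\<^sup>2 + 1 + r" "odd q" "4 \<le> 2 * q + r" "4 \<le> 2 * q - r"
    "4 dvd q - 3 \<longrightarrow> 12 \<le> 2 * q + r"
proof -
  have N16: "16 dvd N"
    using le_imp_power_dvd[of 4 n "2 :: int"] assms by simp
  define t where "t = (LEAST t :: nat. N < 4 * (int t + 1)\<^sup>2)"
  have "N < 4 * (int (nat N) + 1)\<^sup>2"
    using assms by (simp add: power2_eq_square algebra_simps add_pos_nonneg)
  then have up: "N < 4 * (int t + 1)\<^sup>2" unfolding t_def by (rule LeastI)
  have "4 * (int t)\<^sup>2 \<le> N"
  proof (cases t)
    case (Suc u)
    then have "\<not> N < 4 * (int u + 1)\<^sup>2" using not_less_Least[of u "\<lambda>t. N < 4 * (int t + 1)\<^sup>2"] by (simp add: t_def)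
    then show ?thesis using Suc by (simp add: add.commute)
  qed (use assms in simp)
  moreover have "4 * (int t)\<^sup>2 \<noteq> N"
  proof
    assume eq: "4 * (int t)\<^sup>2 = N"
    obtain k where "n = 2 * k + 1" using assms(2) by (rule oddE)
    moreover have "int ((2 * t)\<^sup>2) = int (2 ^ n)" using eq assms(1) by (simp add: power_mult_distrib)
    then have "(2 * t)\<^sup>2 = 2 ^ n" by (simp only: of_nat_eq_iff)
    ultimately show False using square_ne_odd_power_2 by blast
  qed
  ultimately have low: "4 * (int t)\<^sup>2 < N" by simp
  obtain M where M: "N = 16 * M" using N16 by (rule dvdE)
  have low4: "4 \<le> N - 4 * (int t)\<^sup>2" and up4: "4 \<le> 4 * (int t + 1)\<^sup>2 - N"
    using low up unfolding M by presburger+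
  show thesis
  proof (rule that[of "2 * int t + 1" "N - 1 - (2 * int t + 1)\<^sup>2"])
    show "4 dvd 2 * int t + 1 - 3 \<longrightarrow> 12 \<le> 2 * (2 * int t + 1) + (N - 1 - (2 * int t + 1)\<^sup>2)"
    proof
      assume "4 dvd 2 * int t + 1 - 3"
      then have "odd (int t)" by presburger
      then obtain j where j: "int t = 2 * j + 1" by (rule oddE)
      have "N - 4 * (int t)\<^sup>2 = 16 * (M - j\<^sup>2 - j) - 4"
        by (simp add: M j power2_eq_square algebra_simps)
      then have "12 \<le> N - 4 * (int t)\<^sup>2" using low by presburger
      then show "12 \<le> 2 * (2 * int t + 1) + (N - 1 - (2 * int t + 1)\<^sup>2)"
        by (simp add: power2_eq_square algebra_simps)
    qed
  qed (use low4 up4 in \<open>simp add: power2_eq_square algebra_simps\<close>)+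
qed

context sidon_graph
begin

text \<open>The values of \<open>psi\<close> concentrate near the square roots of \<open>N\<close>, which are irrational, but
  they lie in \<open>4 * \<int>\<close> or in \<open>4 * \<int> + 2\<close> according to the character at \<open>\<sigma>\<close>. On either class a
  quartic with roots at the two neighbours of the square root in that class is nonnegative,
  and yet the moments make the sum over all characters that are not bad negative.\<close>

lemma no_two_missing:
  assumes n: "odd CARD('n)" "5 \<le> CARD('n)" and d: "a = N - 2"
  shows False
proof -
  obtain q r where qr: "N = q\<^sup>2 + 1 + r" "odd q" "4 \<le> 2 * q + r" "4 \<le> 2 * q - r"
    and q3: "4 dvd q - 3 \<longrightarrow> 12 \<le> 2 * q + r"
    using odd_between_squares[OF N n] by blast
  have N4: "4 dvd N"
    using le_imp_power_dvd[of 2 "CARD('n)" "2 :: int"] n N by simp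
  obtain x y where xy: "- fst ` A = {x, y}" "x \<noteq> y"
  proof -
    have "card (- fst ` A) = 2" using card_compl d by simp
    then show thesis using that by (auto simp: card_2_iff)
  qed
  have h0: "fst \<sigma> \<noteq> 0" using fst_sigma xy n by simp
  \<comment> \<open>The even numbers \<open>k1\<close> and \<open>k1 + 4\<close> lie in the residue class of \<open>psi\<close> modulo 4 where \<open>chi p \<sigma> = 1\<close>, and \<open>k2\<close>,
    \<open>k2 + 4\<close> in the other class; both intervals contain the square root of \<open>N\<close>.\<close>
  obtain k1 k2 where k: "4 dvd k1 + 2" "4 dvd k2" and kq: "k1 = q - 3 \<and> k2 = q - 1 \<or> k1 = q - 1 \<and> k2 = q - 3 \<and> 12 \<le> 2 * q + r"
  proof (cases "4 dvd q - 1")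
    case True
    then show thesis by (intro that[of "q - 3" "q - 1"]) presburger+
  next
    case False
    then have "4 dvd q - 3" using qr(2) by presburger
    then show thesis using q3 by (intro that[of "q - 1" "q - 3"]) presburger+
  qed
  have cls: "4 dvd psi A p - k1 \<and> 4 dvd psi A p + k1" if "chi p \<sigma> = 1" for p
    using psi_mod_4(1)[OF that] k N4 d a by presburger
  have cls': "4 dvd psi A p - k2 \<and> 4 dvd psi A p + k2" if "chi p \<sigma> = - 1" for p
    using psi_mod_4(2)[OF that] k N4 d a by presburger
  define G where "G p = (1 + chi p \<sigma>) * quartic k1 (psi A p) + (1 - chi p \<sigma>) * quartic k2 (psi A p)" for p
  have G_nonneg: "0 \<le> G p" for p
  proof -
    consider "chi p \<sigma> = 1" | "chi p \<sigma> = - 1" using chi_cases by blast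
    then show ?thesis
      by cases (use cls[of p] cls'[of p] in \<open>auto simp: G_def quartic_def intro!: quartic_nonneg\<close>)
  qed
  let ?c = "\<lambda>k. k\<^sup>2 + (k + 4)\<^sup>2" and ?e = "\<lambda>k. k\<^sup>2 * (k + 4)\<^sup>2"
  have G_eq: "G p = 2 * psi A p ^ 4 - (?c k1 + ?c k2) * (psi A p)\<^sup>2
      - (?c k1 - ?c k2) * ((psi A p)\<^sup>2 * chi p \<sigma>) + (?e k1 + ?e k2) + (?e k1 - ?e k2) * chi p \<sigma>" for p
    unfolding G_def quartic_def by algebra
  have "\<sigma> \<noteq> 0" using h0 by auto
  then have total: "(\<Sum>p\<in>UNIV. G p) = 2 * (N\<^sup>2 * (a * (3 * a - 2))) - (?c k1 + ?c k2) * (N\<^sup>2 * a)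
      - (?c k1 - ?c k2) * (N\<^sup>2 * rep A 2 \<sigma>) + (?e k1 + ?e k2) * N\<^sup>2"
    by (simp only: G_eq sum.distrib sum_subtractf psi_moments sum_chi_UNIV flip: sum_distrib_left)
      (simp add: N power2_eq_square algebra_simps)
  \<comment> \<open>On the remaining bad characters \<open>psi\<close> is at most 2 in absolute value, so its residue modulo 4
    fixes its square.\<close>
  let ?B = "{p \<in> bad. fst p \<noteq> 0}"
  have G_bad: "G p = (1 + chi p \<sigma>) * quartic k1 2 + (1 - chi p \<sigma>) * quartic k2 0" if "p \<in> ?B" for p
  proof -
    have le: "\<bar>psi A p\<bar> \<le> 2" using psi_bad_le that d by simp
    consider "chi p \<sigma> = 1" | "chi p \<sigma> = - 1" using chi_cases by blast
    then show ?thesis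
    proof cases
      case 1
      then have "4 dvd psi A p + 2" using cls[OF 1] k by presburger
      then have "psi A p = 2 \<or> psi A p = - 2" using le by presburger
      then show ?thesis using 1 by (auto simp: G_def quartic_def)
    next
      case 2
      then have "4 dvd psi A p" using cls'[OF 2] k by presburger
      then have "psi A p = 0" using le by presburger
      then show ?thesis using 2 by (auto simp: G_def quartic_def)
    qed
  qed
  have chi_b: "chi (0, b) \<sigma> = 1" using chi_0b hyp_sigma by blast
  have chiB: "(\<Sum>p\<in>?B. chi p \<sigma>) = - 2"
    using sum_chi_bad[OF hyp_sigma] sum_split_bad_0[of "\<lambda>p. chi p \<sigma>"] h0 chi_b by simp
  have cardB: "int (card ?B) = 2 * N - 2"
    using sum_split_bad_0[of "\<lambda>_. 1"] card_bad by simp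
  have "(\<Sum>p\<in>?B. G p) = (\<Sum>p\<in>?B. (quartic k1 2 + quartic k2 0) + (quartic k1 2 - quartic k2 0) * chi p \<sigma>)"
    by (intro sum.cong refl) (subst G_bad, auto simp: algebra_simps)
  also have "\<dots> = (2 * N - 2) * (quartic k1 2 + quartic k2 0) - 2 * (quartic k1 2 - quartic k2 0)"
    by (simp only: sum.distrib chiB sum_constant cardB flip: sum_distrib_left) (simp add: algebra_simps)
  finally have sumB: "(\<Sum>p\<in>?B. G p) = (2 * N - 4) * quartic k1 2 + 2 * N * quartic k2 0"
    by (simp add: algebra_simps)
  have "psi A (0, b) = a" using psi_shift[of 0] psi_0 by simp
  then have "G 0 = 2 * quartic k1 a" "G (0, b) = 2 * quartic k1 a"
    using chi_b by (simp_all add: G_def psi_0)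
  then have sum_bad: "(\<Sum>p\<in>bad. G p) = 4 * quartic k1 a + (2 * N - 4) * quartic k1 2 + 2 * N * quartic k2 0"
    using sum_split_bad_0[of G] sumB by simp
  have "0 \<le> (\<Sum>p\<in>- bad. G p)" by (intro sum_nonneg G_nonneg)
  then have "4 * quartic k1 a + (2 * N - 4) * quartic k1 2 + 2 * N * quartic k2 0 \<le> (\<Sum>p\<in>UNIV. G p)"
    using sum_bad sum_split_bad[of G] by simp
  then have ge: "4 * quartic k1 a + (2 * N - 4) * quartic k1 2 + 2 * N * quartic k2 0
      \<le> N\<^sup>2 * (2 * (a * (3 * a - 2)) - (?c k1 + ?c k2) * a - (?c k1 - ?c k2) * rep A 2 \<sigma> + (?e k1 + ?e k2))"
    unfolding total by (simp add: algebra_simps)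
  have rep: "0 \<le> rep A 2 \<sigma>" "rep A 2 \<sigma> \<le> 2" using sidon_rep_2[OF sidon \<open>\<sigma> \<noteq> 0\<close>] by auto
  have q0: "0 \<le> q" using qr by simp
  from kq show False
  proof
    assume kk: "k1 = q - 3 \<and> k2 = q - 1"
    have "- (?c k1 - ?c k2) * rep A 2 \<sigma> = (8 * q) * rep A 2 \<sigma>"
      unfolding kk[THEN conjunct1] kk[THEN conjunct2] by algebra
    also have "\<dots> \<le> (8 * q) * 2" using rep q0 by (intro mult_left_mono) auto
    finally have *: "- (?c k1 - ?c k2) * rep A 2 \<sigma> \<le> 16 * q" by simp
    have "N\<^sup>2 * (2 * (a * (3 * a - 2)) - (?c k1 + ?c k2) * a - (?c k1 - ?c k2) * rep A 2 \<sigma> + (?e k1 + ?e k2))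
        \<le> N\<^sup>2 * (2 * (a * (3 * a - 2)) - (?c k1 + ?c k2) * a + 16 * q + (?e k1 + ?e k2))"
      by (intro mult_left_mono) (use * in linarith, simp)
    note mono = this
    have e: "k1 + 4 = q + 1" "k2 + 4 = q + 3" "k1 = q - 3" "k2 = q - 1" using kk by auto
    have "N\<^sup>2 * (2 * (a * (3 * a - 2)) - (?c k1 + ?c k2) * a + 16 * q + (?e k1 + ?e k2))
        < 4 * quartic k1 a + (2 * N - 4) * quartic k1 2 + 2 * N * quartic k2 0"
      using moment_balance_1[OF qr(1) d qr(3,4)]
      unfolding e(1,2) unfolding e(3,4) by (simp only: ac_simps)
    then show False using order_trans[OF ge mono] by (meson not_le)
  next
    assume kk: "k1 = q - 1 \<and> k2 = q - 3 \<and> 12 \<le> 2 * q + r"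
    have "- (?c k1 - ?c k2) * rep A 2 \<sigma> = - (8 * q * rep A 2 \<sigma>)"
      unfolding kk[THEN conjunct1] kk[THEN conjunct2, THEN conjunct1] by algebra
    also have "\<dots> \<le> 0" using rep q0 by simp
    finally have *: "- (?c k1 - ?c k2) * rep A 2 \<sigma> \<le> 0" .
    have "N\<^sup>2 * (2 * (a * (3 * a - 2)) - (?c k1 + ?c k2) * a - (?c k1 - ?c k2) * rep A 2 \<sigma> + (?e k1 + ?e k2))
        \<le> N\<^sup>2 * (2 * (a * (3 * a - 2)) - (?c k1 + ?c k2) * a + (?e k1 + ?e k2))"
      by (intro mult_left_mono) (use * in linarith, simp)
    note mono = this
    have e: "k1 + 4 = q + 3" "k2 + 4 = q + 1" "k1 = q - 1" "k2 = q - 3" "12 \<le> 2 * q + r"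
      using kk by auto
    have "N\<^sup>2 * (2 * (a * (3 * a - 2)) - (?c k1 + ?c k2) * a + (?e k1 + ?e k2))
        < 4 * quartic k1 a + (2 * N - 4) * quartic k1 2 + 2 * N * quartic k2 0"
      using moment_balance_2[OF qr(1) d e(5) qr(4)]
      unfolding e(1,2) unfolding e(3,4) by (simp only: ac_simps)
    then show False using order_trans[OF ge mono] by (meson not_le)
  qed
qed

end

section \<open>Three missing points in even dimension\<close>

lemma sum_const_char2:
  fixes u :: "(bit ^ 'n) \<times> (bit ^ 'n)"
  assumes "finite A"
  shows "(\<Sum>t\<in>A. u) = (if odd (card A) then u else 0)"
  using assms by (induction A rule: finite_induct) auto

text \<open>Off-diagonal terms come in equal pairs.\<close>

lemma symmetric_sum_parity:
  fixes f :: "'a \<Rightarrow> 'a \<Rightarrow> int"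
  assumes "finite A" "\<And>s t. f s t = f t s"
  shows "even ((\<Sum>s\<in>A. \<Sum>t\<in>A. f s t) - (\<Sum>s\<in>A. f s s))"
  using assms(1)
proof (induction A rule: finite_induct)
  case (insert x A)
  have "(\<Sum>s\<in>A. f s x) = (\<Sum>t\<in>A. f x t)"
    by (rule sum.cong[OF refl]) (rule assms(2))
  then have "(\<Sum>s\<in>insert x A. \<Sum>t\<in>insert x A. f s t) - (\<Sum>s\<in>insert x A. f s s)
      = ((\<Sum>s\<in>A. \<Sum>t\<in>A. f s t) - (\<Sum>s\<in>A. f s s)) + 2 * (\<Sum>t\<in>A. f x t)"
    using insert by (simp add: sum.distrib)
  then show ?case using insert.IH by simp
qed simp

lemma odd_sum_signs:
  fixes f :: "'a \<Rightarrow> int"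
  assumes "finite A" "\<And>x. x \<in> A \<Longrightarrow> odd (f x)"
  shows "odd (\<Sum>x\<in>A. f x) \<longleftrightarrow> odd (card A)"
  using assms by (induction A rule: finite_induct) auto

lemma even_power_square:
  assumes "even n" "5 \<le> n"
  obtains s :: int where "2 ^ n = s\<^sup>2" "8 dvd s" "8 \<le> s"
proof -
  obtain k where k: "n = 2 * k" using assms(1) by (rule evenE)
  then have "3 \<le> k" using assms by simp
  then have "(2 :: int) ^ 3 dvd 2 ^ k" by (rule le_imp_power_dvd)
  moreover have "(2 :: int) ^ n = (2 ^ k)\<^sup>2" by (simp add: k power_mult mult.commute flip: power_mult)
  ultimately show thesis using zdvd_imp_le[of 8 "2 ^ k"] by (intro that[of "2 ^ k"]) auto
qed

lemma centred_roots:
  fixes y s :: int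
  assumes "((y - 1)\<^sup>2 - s\<^sup>2) * ((y + 3)\<^sup>2 - s\<^sup>2) = 0"
  shows "(y + 1)\<^sup>2 - s\<^sup>2 - 4 = (4 * s) * 1 \<or> (y + 1)\<^sup>2 - s\<^sup>2 - 4 = (4 * s) * (- 1)"
proof -
  have "(y - (1 + s)) * (y - (1 - s)) * (y - (s - 3)) * (y - (- s - 3)) = 0"
    using assms by (simp add: power2_eq_square algebra_simps)
  then consider "y = 1 + s" | "y = 1 - s" | "y = s - 3" | "y = - s - 3" by auto
  then show ?thesis by cases (hypsubst, simp add: power2_eq_square algebra_simps)+
qed

context sidon_graph
begin

lemma translate:
  assumes "bdot b (snd u) = 0"
  shows "sidon_graph ((+) u ` A) b N a"
proof
  show "inj_on fst ((+) u ` A)" using inj by (auto simp: inj_on_def)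
  show "sidon ((+) u ` A)"
    unfolding sidon_def
  proof (intro ballI impI)
    fix r s t v
    assume "r \<in> (+) u ` A" "s \<in> (+) u ` A" "t \<in> (+) u ` A" "v \<in> (+) u ` A" and e: "r + s + t + v = 0"
    then obtain r' s' t' v' where *: "r = u + r'" "s = u + s'" "t = u + t'" "v = u + v'"
      "r' \<in> A" "s' \<in> A" "t' \<in> A" "v' \<in> A" by auto
    have "r + s + t + v = r' + s' + t' + v'" unfolding * by (simp add: ac_simps)
    then have "r' + s' + t' + v' = 0" using e by simp
    then show "r = s \<or> r = t \<or> r = v" using * sidon unfolding sidon_def by blast
  qed
  show "bdot b (snd t) = 0" if "t \<in> (+) u ` A" for t
    using that assms hyp by (auto simp: bdot_add_right)
  show "a = int (card ((+) u ` A))" by (simp add: a card_image)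
qed (rule b N)+

text \<open>The point \<open>t\<close> of \<open>A\<close> above \<open>fst v\<close> occurs in no representation of \<open>v\<close>: \<open>v + t\<close> has first
  coordinate 0, and distinct points of \<open>A\<close> have distinct first coordinates.\<close>

lemma rep_3_le_above:
  assumes "v \<notin> A" "fst v \<in> fst ` A"
  shows "rep A 3 v \<le> 2 * (a - 1)"
proof -
  obtain t where t: "t \<in> A" "fst t = fst v" using assms(2) by auto
  have "v + t \<noteq> 0" using t(1) assms(1) by auto
  have "v + t + u \<notin> A" if "u \<in> A" for u
  proof
    assume "v + t + u \<in> A"
    moreover have "fst (v + t + u) = fst u" by (simp add: t(2))
    ultimately have "v + t + u = u" using inj that by (metis inj_onD)
    then show False using \<open>v + t \<noteq> 0\<close> by simp
  qed
  then have "rep A 2 (v + t) = 0" by (simp add: rep_2)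
  then have "rep A 3 v = (\<Sum>u\<in>A - {t}. rep A 2 (v + u))" using t(1) by (simp add: rep_3 sum.remove)
  also have "\<dots> \<le> (\<Sum>u\<in>A - {t}. 2)"
  proof (rule sum_mono)
    fix u assume "u \<in> A - {t}"
    then have "v + u \<noteq> 0" using assms by auto
    then show "rep A 2 (v + u) \<le> 2" using sidon_rep_2[OF sidon] by fastforce
  qed
  also have "\<dots> = 2 * (a - 1)" using t(1) card_gt_0_iff[of A] by (auto simp: a of_nat_diff Suc_leI)
  finally show ?thesis .
qed

lemma sum_chi_axis:
  fixes v :: "(bit ^ 'n) \<times> (bit ^ 'n)"
  shows "(\<Sum>p\<in>{0} \<times> UNIV. chi p v) = (if snd v = 0 then N else 0)"
proof -
  have "subgp ({0} \<times> (UNIV :: (bit ^ 'n) set))" by (auto simp: subgp_def zero_prod_def)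
  note * = sum_chi_subgp[OF this, of v]
  show ?thesis
  proof (cases "snd v = 0")
    case True
    then have "\<forall>p\<in>{0} \<times> UNIV. chi p v = 1" by (auto simp: chi_def)
    then show ?thesis using * True by (simp add: N card_cartesian_product)
  next
    case False
    then obtain y where "bdot y (snd v) = 1" by (rule bdot_nondegenerate)
    then have "(0, y) \<in> {0} \<times> UNIV" "chi (0, y) v \<noteq> 1" by (auto simp: chi_def)
    then show ?thesis using * False by auto
  qed
qed

text \<open>All values of \<open>psi\<close> are 1 modulo 4, and the quartic with roots \<open>1 + s\<close>, \<open>1 - s\<close>, \<open>-3 + s\<close>,
  \<open>-3 - s\<close> is nonnegative on this class. Its sum over the characters that are not bad is
  determined by the third moment at 0, and turns out to be at most 0. So all these \<open>psi\<close> are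
  roots, whence \<open>(psi + 1)\<^sup>2\<close> is \<open>N + 4 + 4 * s\<close> or \<open>N + 4 - 4 * s\<close> throughout. As for bent
  vectorial functions, such a sign pattern is incompatible with divisibility by powers of 2.\<close>

lemma no_three_missing_centred:
  assumes n: "even CARD('n)" "5 \<le> CARD('n)" and d: "a = N - 3" and \<sigma>: "\<sigma> = 0"
  shows False
proof -
  obtain s where s: "N = s\<^sup>2" "8 dvd s" "8 \<le> s" using even_power_square[OF n] N by metis
  have N4: "4 dvd N" using s by (auto simp: power2_eq_square elim!: dvdE)
  have cls: "4 dvd psi A p - 1" for p
    using psi_mod_4(1)[of p A] N4 d a \<sigma> by simp presburger
  define P where "P p = ((psi A p - 1)\<^sup>2 - N) * ((psi A p + 3)\<^sup>2 - N)" for p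
  have P_nonneg: "0 \<le> P p" for p
  proof -
    have "4 dvd psi A p - 1 - s" "4 dvd psi A p - 1 + s"
      using cls[of p] s(2) by presburger+
    from mult_nonneg_nonneg[OF consecutive_nonneg[OF this(1)] consecutive_nonneg[OF this(2)]]
    show ?thesis unfolding P_def s(1) by (simp add: power2_eq_square algebra_simps)
  qed
  have P_eq: "P p = psi A p ^ 4 + 4 * (psi A p ^ 3 * chi p 0) - (2 * N + 2) * (psi A p)\<^sup>2
      - (12 + 4 * N) * (psi A p * chi p 0) + (N - 1) * (N - 9)" for p
    unfolding P_def chi_zero by algebra
  have total: "(\<Sum>p\<in>UNIV. P p) = N\<^sup>2 * (a * (3 * a - 2) + 4 * rep A 3 0 - (2 * N + 2) * a
      - (12 + 4 * N) * of_bool (0 \<in> A) + (N - 1) * (N - 9))"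
    by (simp only: P_eq sum.distrib sum_subtractf psi_moments flip: sum_distrib_left)
      (simp add: N power2_eq_square algebra_simps)
  \<comment> \<open>Here \<open>psi\<close> is 1 or -3, and the polynomial takes the same value at both.\<close>
  let ?B = "{p \<in> bad. fst p \<noteq> 0}"
  have P_bad: "P p = N\<^sup>2 - 16 * N" if "p \<in> ?B" for p
  proof -
    have "\<bar>psi A p\<bar> \<le> 3" using psi_bad_le that d by simp
    then have "psi A p = 1 \<or> psi A p = - 3" using cls[of p] by presburger
    then show ?thesis by (auto simp: P_def power2_eq_square algebra_simps)
  qed
  have cardB: "int (card ?B) = 2 * N - 2"
    using sum_split_bad_0[of "\<lambda>_. 1"] card_bad by simp
  have "psi A (0, b) = a" using psi_shift[of 0] psi_0 by simp
  then have "P 0 = ((N - 4)\<^sup>2 - N) * (N\<^sup>2 - N)" "P (0, b) = ((N - 4)\<^sup>2 - N) * (N\<^sup>2 - N)"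
    by (simp_all add: P_def psi_0 d)
  moreover have "(\<Sum>p\<in>?B. P p) = (2 * N - 2) * (N\<^sup>2 - 16 * N)"
    by (simp only: P_bad sum_constant cardB cong: sum.cong)
  ultimately have sum_bad: "(\<Sum>p\<in>bad. P p) = 2 * (((N - 4)\<^sup>2 - N) * (N\<^sup>2 - N)) + (2 * N - 2) * (N\<^sup>2 - 16 * N)"
    using sum_split_bad_0[of P] by simp
  have good: "(\<Sum>p\<in>- bad. P p) = N\<^sup>2 * (4 * rep A 3 0 - 8 * N + 32 - (12 + 4 * N) * of_bool (0 \<in> A))"
    using sum_split_bad[of P] unfolding total sum_bad d by algebra
  have fst0: "0 \<in> fst ` A"
  proof (rule ccontr)
    assume "0 \<notin> fst ` A"
    have "card (- fst ` A) = 3" using card_compl d by simp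
    moreover have "0 \<in> - fst ` A" using \<open>0 \<notin> fst ` A\<close> by simp
    ultimately have "card (- fst ` A - {0}) = 2" by simp
    then obtain x y where xy: "- fst ` A - {0} = {x, y}" "x \<noteq> y" by (auto simp: card_2_iff)
    have "\<Sum>(- fst ` A) = 0 + \<Sum>(- fst ` A - {0})" using \<open>0 \<in> - fst ` A\<close> by (simp add: sum.remove)
    then show False using fst_sigma xy n \<sigma> by simp
  qed
  have P_0: "P p = 0" if "p \<notin> bad" for p
  proof -
    have "(\<Sum>p\<in>- bad. P p) \<le> 0"
    proof (cases "0 \<in> A")
      case True
      have "rep A 3 0 = 3 * a - 2" using rep_3_member[OF sidon True] a by simp
      then have "4 * rep A 3 0 - 8 * N + 32 - (12 + 4 * N) * of_bool (0 \<in> A) \<le> 0"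
        using True d by simp
      then show ?thesis unfolding good by (intro mult_nonneg_nonpos) auto
    next
      case False
      then have "rep A 3 0 \<le> 2 * (a - 1)" using fst0 by (intro rep_3_le_above) auto
      then have "4 * rep A 3 0 - 8 * N + 32 - (12 + 4 * N) * of_bool (0 \<in> A) \<le> 0"
        using False d by simp
      then show ?thesis unfolding good by (intro mult_nonneg_nonpos) auto
    qed
    moreover have "0 \<le> (\<Sum>p\<in>- bad. P p)" by (intro sum_nonneg P_nonneg)
    ultimately have "(\<Sum>p\<in>- bad. P p) = 0" by simp
    then show ?thesis using that P_nonneg by (simp add: sum_nonneg_eq_0_iff)
  qed
  \<comment> \<open>The signs \<open>\<tau>\<close> cannot be arranged: the sum of \<open>(psi + 1)\<^sup>2\<close> over the characters \<open>(0, y)\<close> is a multiple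
    of \<open>2 * N\<close>, but apart from multiples of \<open>2 * N\<close> it equals \<open>8 * s\<close> times a sum of an odd number of signs, because each
    character is paired with its translate by \<open>(0, b)\<close>.\<close>
  define \<tau> where "\<tau> p = (((psi A p + 1)\<^sup>2 - N - 4) div (4 * s))" for p
  have \<tau>: "(psi A p + 1)\<^sup>2 = N + 4 + 4 * s * \<tau> p \<and> odd (\<tau> p)" if "p \<notin> bad" for p
  proof -
    have "(psi A p + 1)\<^sup>2 - N - 4 = (4 * s) * 1 \<or> (psi A p + 1)\<^sup>2 - N - 4 = (4 * s) * (- 1)"
      using P_0[OF that] unfolding P_def s(1) by (rule centred_roots)
    then have "\<tau> p = 1 \<and> (psi A p + 1)\<^sup>2 - N - 4 = (4 * s) * 1
        \<or> \<tau> p = - 1 \<and> (psi A p + 1)\<^sup>2 - N - 4 = (4 * s) * (- 1)"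
      using s(3) unfolding \<tau>_def by (metis nonzero_mult_div_cancel_left mult_eq_0_iff not_numeral_le_zero zero_neq_numeral)
    then show ?thesis by auto
  qed
  obtain i where i: "b $ i = 1" using b by (auto simp: vec_eq_iff)
  define C0 where "C0 = {p :: (bit ^ 'n) \<times> (bit ^ 'n). fst p = 0 \<and> snd p $ i = 0}"
  define C1 where "C1 = {p :: (bit ^ 'n) \<times> (bit ^ 'n). fst p = 0 \<and> snd p $ i = 1}"
  have C: "{0} \<times> UNIV = C0 \<union> C1" "C0 \<inter> C1 = {}" by (auto simp: C0_def C1_def)
  have sumC: "(\<Sum>p\<in>{0} \<times> UNIV. f p) = (\<Sum>p\<in>C0. f p) + (\<Sum>p\<in>C0. f (p + (0, b)))" for f :: "_ \<Rightarrow> int"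
  proof -
    have "(\<Sum>p\<in>C0. f (p + (0, b))) = (\<Sum>p\<in>C1. f p)"
      by (rule sum_translate) (auto simp: C0_def C1_def i)
    then show ?thesis by (simp only: C(1)) (simp add: sum.union_disjoint C(2))
  qed
  have cardC0: "N = 2 * int (card C0)"
    using sumC[of "\<lambda>_. 1"] by (simp add: N card_cartesian_product)
  have "(\<Sum>p\<in>{0} \<times> UNIV. (psi A p)\<^sup>2) = (\<Sum>r\<in>A. \<Sum>t\<in>A. \<Sum>p\<in>{0} \<times> UNIV. chi p (r + t))"
    using psi_square_sum[where L = "{0} \<times> UNIV" and v = 0] by simp
  also have "\<dots> = (\<Sum>r\<in>A. \<Sum>t\<in>A. N * of_bool (snd r = snd t))"
    by (intro sum.cong refl) (simp add: sum_chi_axis)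
  also have "\<dots> = N * (\<Sum>r\<in>A. \<Sum>t\<in>A. of_bool (snd r = snd t))"
    by (simp only: sum_distrib_left)
  finally have psi2: "(\<Sum>p\<in>{0} \<times> UNIV. (psi A p)\<^sup>2) = N * (\<Sum>r\<in>A. \<Sum>t\<in>A. of_bool (snd r = snd t))" .
  have "even ((\<Sum>r\<in>A. \<Sum>t\<in>A. of_bool (snd r = snd t)) - (\<Sum>r\<in>A. of_bool (snd r = snd r) :: int))"
    by (rule symmetric_sum_parity) auto
  then have "even ((\<Sum>r\<in>A. \<Sum>t\<in>A. of_bool (snd r = snd t)) - a)" by (simp add: a)
  then obtain m where m: "(\<Sum>r\<in>A. \<Sum>t\<in>A. of_bool (snd r = snd t)) = a + 2 * m"
    by (metis add.commute diff_add_cancel evenE)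
  have psi1: "\<exists>t0. (\<Sum>p\<in>{0} \<times> UNIV. psi A p) = N * t0"
  proof -
    have "(\<Sum>p\<in>{0} \<times> UNIV. psi A p) = (\<Sum>t\<in>A. \<Sum>p\<in>{0} \<times> UNIV. chi p t)"
      unfolding psi_def by (rule sum.swap)
    also have "\<dots> = N * (\<Sum>t\<in>A. of_bool (snd t = 0))"
      by (simp add: sum_chi_axis sum_distrib_left of_bool_def if_distrib cong: if_cong)
    finally show ?thesis by blast
  qed
  then obtain t0 where t0: "(\<Sum>p\<in>{0} \<times> UNIV. psi A p) = N * t0" by blast
  have "(\<Sum>p\<in>{0} \<times> UNIV. (psi A p + 1)\<^sup>2)
      = (\<Sum>p\<in>{0} \<times> UNIV. (psi A p)\<^sup>2) + 2 * (\<Sum>p\<in>{0} \<times> UNIV. psi A p) + N"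
    by (simp add: power2_sum sum.distrib sum_distrib_left N card_cartesian_product)
  then have lhs: "(\<Sum>p\<in>{0} \<times> UNIV. (psi A p + 1)\<^sup>2) = N * (a + 2 * m + 2 * t0 + 1)"
    unfolding psi2 m t0 by (simp only: distrib_left mult.left_commute mult_1_right)
  have zero: "0 \<in> C0" by (simp add: C0_def)
  have C0_good: "p \<notin> bad" if "p \<in> C0 - {0}" for p
    using that i by (auto simp: C0_def bad_def prod_eq_iff)
  have "(\<Sum>p\<in>{0} \<times> UNIV. (psi A p + 1)\<^sup>2) = 2 * (\<Sum>p\<in>C0. (psi A p + 1)\<^sup>2)"
    using sumC[of "\<lambda>p. (psi A p + 1)\<^sup>2"] by (simp add: psi_shift)
  also have "(\<Sum>p\<in>C0. (psi A p + 1)\<^sup>2) = (a + 1)\<^sup>2 + (\<Sum>p\<in>C0 - {0}. (psi A p + 1)\<^sup>2)"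
    using zero by (subst sum.remove[of _ 0]) (auto simp: psi_0)
  also have "(\<Sum>p\<in>C0 - {0}. (psi A p + 1)\<^sup>2) = (\<Sum>p\<in>C0 - {0}. N + 4 + 4 * s * \<tau> p)"
    using \<tau> C0_good by (intro sum.cong refl) auto
  also have "\<dots> = (int (card C0) - 1) * (N + 4) + 4 * s * (\<Sum>p\<in>C0 - {0}. \<tau> p)"
  proof -
    have "int (card (C0 - {0})) = int (card C0) - 1"
      using zero card_gt_0_iff[of C0] by (auto simp: of_nat_diff Suc_leI)
    then show ?thesis by (simp only: sum.distrib sum_constant distrib_left flip: sum_distrib_left)
  qed
  finally have rhs: "(\<Sum>p\<in>{0} \<times> UNIV. (psi A p + 1)\<^sup>2)
      = 2 * ((a + 1)\<^sup>2 + ((int (card C0) - 1) * (N + 4) + 4 * s * (\<Sum>p\<in>C0 - {0}. \<tau> p)))" .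
  define M T where "M = int (card C0)" and "T = (\<Sum>p\<in>C0 - {0}. \<tau> p)"
  have "2 * M * (2 * M - 2 + 2 * m + 2 * t0) = 2 * ((2 * M - 2)\<^sup>2 + ((M - 1) * (2 * M + 4) + 4 * s * T))"
    using lhs rhs cardC0 d unfolding M_def[symmetric] T_def[symmetric] by simp
  then have "2 * M * (M - 1 + m + t0 - 3 * M + 3) = 4 * s * T" by algebra
  then have "s * (s * (2 - 2 * M + m + t0)) = s * (4 * T)"
    using cardC0 s(1) unfolding M_def[symmetric] by algebra
  then have "s * (2 - 2 * M + m + t0) = 4 * T" using s(3) by simp
  then have "8 dvd 4 * T" using s(2) by (metis dvd_mult2)
  then have "even T" by presburger
  moreover have "odd T"
  proof -
    have "even M"
    proof -
      have "4 dvd 2 * M" using N4 cardC0 M_def by simp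
      then show ?thesis by presburger
    qed
    then have "odd (card (C0 - {0}))" using zero by (simp add: M_def card_Diff_singleton) (metis card_gt_0_iff even_Suc Suc_pred' finite equals0D)
    moreover have "odd (\<Sum>p\<in>C0 - {0}. \<tau> p) \<longleftrightarrow> odd (card (C0 - {0}))"
      using \<tau> C0_good by (intro odd_sum_signs) auto
    ultimately show ?thesis by (simp add: T_def)
  qed
  ultimately show False by simp
qed

text \<open>Translation by \<open>\<sigma>\<close> moves the sum of an odd number of points to 0.\<close>

lemma no_three_missing:
  assumes n: "even CARD('n)" "5 \<le> CARD('n)" and d: "a = N - 3"
  shows False
proof -
  interpret B: sidon_graph "(+) \<sigma> ` A" b N a by (rule translate) (rule hyp_sigma)
  obtain s where s: "N = s\<^sup>2" "8 dvd s" using even_power_square[OF n] N by metis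
  have "even N" using s by (auto simp: power2_eq_square elim!: dvdE)
  then have "odd (card A)" using d a by presburger
  have "\<Sum>((+) \<sigma> ` A) = (\<Sum>t\<in>A. \<sigma> + t)" by (simp add: sum.reindex)
  also have "\<dots> = 0" using \<open>odd (card A)\<close> by (simp add: sum.distrib sum_const_char2)
  finally show False using B.no_three_missing_centred n d by blast
qed

end

section \<open>Quadratic sign functions\<close>

lemma sum_translate_sub:
  fixes L :: "((bit ^ 'n) \<times> (bit ^ 'n)) set"
  assumes "subgp L" "q \<in> L"
  shows "(\<Sum>p\<in>L. f (p + q)) = (\<Sum>p\<in>L. f p)"
  using assms by (intro sum_translate) (auto simp: subgp_def)

lemma pm_one_mult: "(x :: int) = 1 \<or> x = - 1 \<Longrightarrow> y = 1 \<or> y = - 1 \<Longrightarrow> x * y = 1 \<or> x * y = - 1"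
  by auto

text \<open>The function \<open>s\<close> is \<open>(-1)\<^sup>f\<close> for a function \<open>f\<close> of degree at most 2: the second
  differences of \<open>f\<close> do not depend on the base point.\<close>

locale sign_quadratic =
  fixes K :: "((bit ^ 'n) \<times> (bit ^ 'n)) set" and s :: "(bit ^ 'n) \<times> (bit ^ 'n) \<Rightarrow> int"
  assumes K: "subgp K" and sign: "\<And>c. c \<in> K \<Longrightarrow> s c = 1 \<or> s c = - 1"
    and quad: "\<And>c p q. c \<in> K \<Longrightarrow> p \<in> K \<Longrightarrow> q \<in> K \<Longrightarrow>
      s c * s (c + p) * s (c + q) * s (c + p + q) = s 0 * s p * s q * s (p + q)"
begin

definition polar where "polar p q = s 0 * s p * s q * s (p + q)"

lemma K_simps [simp]: "0 \<in> K" "p \<in> K \<Longrightarrow> q \<in> K \<Longrightarrow> p + q \<in> K"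
  using K by (auto simp: subgp_def)

lemma polar_sign: "p \<in> K \<Longrightarrow> q \<in> K \<Longrightarrow> polar p q = 1 \<or> polar p q = - 1"
  unfolding polar_def by (intro pm_one_mult sign) auto

lemma value_half:
  assumes "\<And>p q. p \<in> K \<Longrightarrow> q \<in> K \<Longrightarrow> polar p q = 1" and c0: "c0 \<in> K"
  shows "card K \<le> 2 * card {c \<in> K. s c = s c0}"
proof (cases "\<forall>c\<in>K. s c = s c0")
  case True
  then have "{c \<in> K. s c = s c0} = K" by auto
  then show ?thesis by simp
next
  case False
  then obtain c1 where c1: "c1 \<in> K" "s c1 \<noteq> s c0" by auto
  let ?p = "c0 + c1" and ?X = "{c \<in> K. s c = s c0}"
  have "1 \<le> of_bool (c \<in> ?X) + (of_bool (c + ?p \<in> ?X) :: nat)" if c: "c \<in> K" for c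
  proof -
    have "s c0 * s (c0 + ?p) * s (c0 + (c0 + c)) * s (c0 + ?p + (c0 + c)) = 1"
      using quad[of c0 ?p "c0 + c"] assms(1)[of ?p "c0 + c"] c c0 c1 by (simp add: polar_def)
    moreover have "c0 + ?p + (c0 + c) = c + ?p" by (simp add: ac_simps)
    ultimately have "s c0 * s c1 * s c * s (c + ?p) = 1" by (simp add: ac_simps)
    then show ?thesis using sign[OF c] sign[OF c0] sign[OF c1(1)] sign[of "c + ?p"] c c0 c1 by auto
  qed
  then have "(\<Sum>c\<in>K. 1) \<le> (\<Sum>c\<in>K. of_bool (c \<in> ?X) + (of_bool (c + ?p \<in> ?X) :: nat))"
    by (rule sum_mono)
  also have "\<dots> = (\<Sum>c\<in>K. of_bool (c \<in> ?X)) + (\<Sum>c\<in>K. of_bool (c \<in> ?X))"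
    using sum_translate_sub[OF K, of ?p "\<lambda>c. of_bool (c \<in> ?X) :: nat"] c0 c1
    by (simp only: sum.distrib K_simps)
  also have "(\<Sum>c\<in>K. of_bool (c \<in> ?X)) = card ?X" by (simp add: Int_def)
  finally show ?thesis by simp
qed

text \<open>The minimum distance of the second order Reed-Muller code. If the polar form is -1 at \<open>p\<close>
  and \<open>q\<close>, the product of \<open>s\<close> over any coset of \<open>{0, p, q, p + q}\<close> is -1, so both values
  occur in the coset; otherwise \<open>f\<close> is affine.\<close>

lemma value_quarter:
  assumes c0: "c0 \<in> K"
  shows "card K \<le> 4 * card {c \<in> K. s c = s c0}"
proof (cases "\<forall>p\<in>K. \<forall>q\<in>K. polar p q = 1")
  case True
  then show ?thesis using value_half[of c0] c0 by auto
next
  case False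
  then obtain p q where pq: "p \<in> K" "q \<in> K" "polar p q = - 1" using polar_sign by blast
  let ?X = "{c \<in> K. s c = s c0}"
  have "1 \<le> of_bool (c \<in> ?X) + of_bool (c + p \<in> ?X) + of_bool (c + q \<in> ?X) + (of_bool (c + (p + q) \<in> ?X) :: nat)"
    if c: "c \<in> K" for c
  proof -
    have "s c * s (c + p) * s (c + q) * s (c + (p + q)) = - 1"
      using quad[OF c pq(1,2)] pq(3) by (simp add: polar_def add.assoc)
    then show ?thesis using sign[OF c] sign[OF c0] sign[of "c + p"] sign[of "c + q"] sign[of "c + (p + q)"] c pq
      by auto
  qed
  then have "(\<Sum>c\<in>K. 1) \<le> (\<Sum>c\<in>K. of_bool (c \<in> ?X) + of_bool (c + p \<in> ?X) + of_bool (c + q \<in> ?X)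
      + (of_bool (c + (p + q) \<in> ?X) :: nat))"
    by (rule sum_mono)
  also have "\<dots> = 4 * (\<Sum>c\<in>K. of_bool (c \<in> ?X))"
    using sum_translate_sub[OF K, of _ "\<lambda>c. of_bool (c \<in> ?X) :: nat"] pq by (simp only: sum.distrib K_simps)
  also have "(\<Sum>c\<in>K. of_bool (c \<in> ?X)) = card ?X" by (simp add: Int_def)
  finally show ?thesis by simp
qed

lemma polar_add:
  assumes "c \<in> K" "c' \<in> K" "p \<in> K"
  shows "polar (c + c') p = polar c p * polar c' p"
proof -
  have "polar c p = s c' * s (c' + c) * s (c' + p) * s (c' + c + p)"
    using quad[of c' c p] assms by (simp add: polar_def)
  moreover have "s c' * s c' = 1" "s (c' + p) * s (c' + p) = 1"
    using sign[of c'] sign[of "c' + p"] assms by auto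
  ultimately show ?thesis unfolding polar_def add.commute[of c c'] by algebra
qed

lemma polar_commute: "polar p q = polar q p"
  by (simp add: polar_def add.commute)

lemma polar_self: "p \<in> K \<Longrightarrow> polar p p = 1"
  using sign[of 0] sign[of p] by (auto simp: polar_def)

lemma polar_0: "p \<in> K \<Longrightarrow> polar 0 p = 1"
  using sign[of 0] sign[of p] by (auto simp: polar_def)

lemma s_add:
  assumes "c \<in> K" "p \<in> K" "polar c p = 1"
  shows "s (c + p) = s c * s p * s 0"
proof -
  have "s 0 * s 0 = 1" "s c * s c = 1" "s p * s p = 1"
    using sign[of 0] sign[of c] sign[of p] assms by auto
  then show ?thesis using assms(3) unfolding polar_def by algebra
qed

text \<open>Quadratic functions have no density strictly between 1/4 and 3/8. The orthogonal
  complement \<open>R\<close> of a pair \<open>p\<close>, \<open>q\<close> with polar form -1 has index 4, and the sum of \<open>s\<close> over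
  \<open>K\<close> is \<open>\<plusminus>2\<close> times its sum over \<open>R\<close>. If the density of -1 is below 3/8, the sum over \<open>R\<close>
  exceeds half of \<open>card R\<close> in absolute value, so \<open>s\<close> is constant on \<open>R\<close> by the minimum
  distance, and then \<open>R\<close> is exactly the set where \<open>s\<close> is -1.\<close>

lemma quadratic_density:
  assumes s0: "s 0 = - 1"
  shows "3 * card K \<le> 8 * card {c \<in> K. s c = - 1}
    \<or> subgp {c \<in> K. s c = - 1} \<and> 4 * card {c \<in> K. s c = - 1} = card K"
proof (cases "\<forall>p\<in>K. \<forall>q\<in>K. polar p q = 1")
  case True
  then have "card K \<le> 2 * card {c \<in> K. s c = - 1}" using value_half[of 0] s0 by auto
  then show ?thesis by simp
next
  case False
  then obtain p q where pq: "p \<in> K" "q \<in> K" "polar p q = - 1" using polar_sign by blast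
  define R where "R = {c \<in> K. polar c p = 1 \<and> polar c q = 1}"
  have RK: "R \<subseteq> K" by (auto simp: R_def)
  have R: "subgp R" using pq by (auto simp: subgp_def R_def polar_0 polar_add)
  have qp: "polar q p = - 1" using pq(3) by (simp add: polar_commute)
  have mem: "c + p \<in> R \<longleftrightarrow> polar c p = 1 \<and> polar c q = - 1" "c + q \<in> R \<longleftrightarrow> polar c p = - 1 \<and> polar c q = 1"
    "c + (p + q) \<in> R \<longleftrightarrow> polar c p = - 1 \<and> polar c q = - 1" if "c \<in> K" for c
    using that pq qp by (auto simp: R_def polar_add polar_self)
  have one: "of_bool (c \<in> R) + of_bool (c + p \<in> R) + of_bool (c + q \<in> R) + of_bool (c + (p + q) \<in> R) = (1 :: int)"
    if "c \<in> K" for c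
    using polar_sign[OF that pq(1)] polar_sign[OF that pq(2)] that by (auto simp: mem) (auto simp: R_def)
  have decomp: "(\<Sum>c\<in>K. h c) = (\<Sum>c\<in>R. h c + h (c + p) + h (c + q) + h (c + (p + q)))" for h :: "_ \<Rightarrow> int"
  proof -
    have tr: "(\<Sum>c\<in>K. h c * of_bool (c + m \<in> R)) = (\<Sum>c\<in>R. h (c + m))" if "m \<in> K" for m
    proof -
      have "(\<Sum>c\<in>K. h c * of_bool (c + m \<in> R)) = (\<Sum>c\<in>K. h (c + m) * of_bool (c + m + m \<in> R))"
        using sum_translate_sub[OF K that, of "\<lambda>c. h c * of_bool (c + m \<in> R)"] by simp
      also have "\<dots> = (\<Sum>c\<in>R. h (c + m))"
        using RK by (intro sum.mono_neutral_cong_right) (auto simp: add.assoc)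
      finally show ?thesis .
    qed
    have "(\<Sum>c\<in>K. h c) = (\<Sum>c\<in>K. h c * (of_bool (c + 0 \<in> R) + of_bool (c + p \<in> R) + of_bool (c + q \<in> R) + of_bool (c + (p + q) \<in> R)))"
      using one by (intro sum.cong) auto
    also have "\<dots> = (\<Sum>c\<in>R. h (c + 0)) + (\<Sum>c\<in>R. h (c + p)) + (\<Sum>c\<in>R. h (c + q)) + (\<Sum>c\<in>R. h (c + (p + q)))"
      using pq by (simp only: distrib_left sum.distrib tr K_simps)
    finally show ?thesis by (simp add: sum.distrib)
  qed
  have cardK: "int (card K) = 4 * int (card R)"
    using decomp[of "\<lambda>_. 1"] by simp
  define \<tau> where "\<tau> = s 0 + s p + s q + s (p + q)"
  have shift: "s (c + m) = - (s c * s m)" if "c \<in> R" "m = p \<or> m = q \<or> m = p + q" for c m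
  proof -
    have "c \<in> K" "m \<in> K" using that pq RK by auto
    moreover have "polar c m = 1"
      using that pq RK polar_add[of p q c] by (auto simp: R_def polar_commute[of c "p + q"] polar_commute[of p c] polar_commute[of q c])
    ultimately show ?thesis using s_add s0 by simp
  qed
  have sumK: "(\<Sum>c\<in>K. s c) = - \<tau> * (\<Sum>c\<in>R. s c)"
  proof -
    have "(\<Sum>c\<in>K. s c) = (\<Sum>c\<in>R. - \<tau> * s c)"
      unfolding decomp by (intro sum.cong refl) (simp add: shift \<tau>_def s0 algebra_simps)
    then show ?thesis by (simp only: sum_distrib_left)
  qed
  have sumQ: "(\<Sum>c\<in>L. s c) = int (card L) - 2 * int (card {c \<in> L. s c = - 1})" if "L \<subseteq> K" for L
  proof -
    have "(\<Sum>c\<in>L. s c) = (\<Sum>c\<in>L. 1 - 2 * of_bool (s c = - 1))"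
      using sign that by (intro sum.cong) auto
    also have "\<dots> = int (card L) - 2 * (\<Sum>c\<in>L. of_bool (s c = - 1))"
      by (simp only: sum_subtractf sum_distrib_left) simp
    also have "(\<Sum>c\<in>L. of_bool (s c = - 1)) = int (card {c \<in> L. s c = - 1})"
      by (simp add: Int_def)
    finally show ?thesis .
  qed
  have prod: "s 0 * s p * s q * s (p + q) = - 1" using pq(3) by (simp add: polar_def)
  have \<tau>: "\<tau> = 2 \<and> s p = 1 \<and> s q = 1 \<and> s (p + q) = 1 \<or> \<tau> = - 2"
    using prod sign[OF pq(1)] sign[OF pq(2)] s0 by (auto simp: \<tau>_def)
  show ?thesis
  proof (rule disjCI)
    assume "\<not> (subgp {c \<in> K. s c = - 1} \<and> 4 * card {c \<in> K. s c = - 1} = card K)"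
    show "3 * card K \<le> 8 * card {c \<in> K. s c = - 1}"
    proof (rule ccontr)
      assume small: "\<not> 3 * card K \<le> 8 * card {c \<in> K. s c = - 1}"
      then have "int (card R) < - \<tau> * (\<Sum>c\<in>R. s c)"
        using sumQ[OF subset_refl] sumK cardK by linarith
      then have large: "int (card R) < 2 * \<bar>\<Sum>c\<in>R. s c\<bar>" and sgn: "\<tau> = 2 \<or> 0 < (\<Sum>c\<in>R. s c)"
        using \<tau> by auto
      have neg: "s c = - 1" if "c \<in> R" for c
      proof (rule ccontr)
        assume "s c \<noteq> - 1"
        then have c: "s c = 1" "c \<in> R" using sign[of c] that RK by blast+
        interpret R: sign_quadratic R s
          using R sign quad RK by unfold_locales blast+
        have "0 \<in> R" using R by (simp add: subgp_def)
        have "card R \<le> 4 * card {c \<in> R. s c = - 1}" "card R \<le> 4 * card {c \<in> R. s c = 1}"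
          using R.value_quarter[OF \<open>0 \<in> R\<close>] R.value_quarter[OF c(2)] s0 c by auto
        moreover have "card R = card {c \<in> R. s c = - 1} + card {c \<in> R. s c = 1}"
        proof (subst card_Un_disjoint[symmetric])
          show "card R = card ({c \<in> R. s c = - 1} \<union> {c \<in> R. s c = 1})"
            by (rule arg_cong[where f = card]) (use sign RK in blast)
        qed auto
        ultimately show False using large sumQ[OF RK] by linarith
      qed
      then have "(\<Sum>c\<in>R. s c) = - int (card R)" by (simp add: sum_negf)
      then have \<tau>2: "s p = 1 \<and> s q = 1 \<and> s (p + q) = 1" using sgn \<tau> by auto
      have "{c \<in> K. s c = - 1} = R"
      proof (intro equalityI subsetI)
        fix c assume "c \<in> {c \<in> K. s c = - 1}"
        then have c: "c \<in> K" "s c = - 1" by auto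
        show "c \<in> R"
        proof (rule ccontr)
          assume "c \<notin> R"
          then have "c + p \<in> R \<or> c + q \<in> R \<or> c + (p + q) \<in> R"
            using one[OF c(1)] by (auto split: if_splits simp: of_bool_def)
          then obtain m where m: "m = p \<or> m = q \<or> m = p + q" "c + m \<in> R" by blast
          have "s (c + m + m) = - (s (c + m) * s m)" by (rule shift) (use m in auto)
          then show False using c neg[OF m(2)] m(1) \<tau>2 by (auto simp: add.assoc)
        qed
      qed (use neg RK in auto)
      then show False using R cardK \<open>\<not> (subgp _ \<and> _)\<close> by simp
    qed
  qed
qed

end

section \<open>Four missing points in even dimension\<close>

lemma sign_product_4:
  fixes x y z w :: int
  shows "(if even x then 1 else - 1) * (if even y then 1 else - 1) * (if even z then 1 else - 1)
    * (if even w then 1 else - 1) = (if even (x + y + z + w) then 1 else (- 1 :: int))"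
  by auto

text \<open>A relation between four points that involves \<open>v\<close> once writes \<open>v\<close> as a sum of three points
  of \<open>A\<close>.\<close>

lemma sidon_insert:
  assumes "sidon A" "rep A 3 v = 0"
  shows "sidon (insert v A)"
proof -
  have no: "r + s + t \<noteq> v" if "r \<in> A" "s \<in> A" "t \<in> A" for r s t
  proof
    assume "r + s + t = v"
    then have "v + r + s = t" by (auto simp: ac_simps)
    then have "{t \<in> A. v + r + t \<in> A} \<noteq> {}" using that by blast
    then have "0 < rep A 2 (v + r)" by (simp add: rep_2 card_gt_0_iff)
    then have "0 < rep A 3 v"
      unfolding rep_3 using that(1) rep_nonneg[of A 2] by (intro sum_pos2[of A r]) auto
    then show False using assms(2) by simp
  qed
  have no': "r + s + t + v \<noteq> 0" "r + s + v + t \<noteq> 0" "r + v + s + t \<noteq> 0" "v + r + s + t \<noteq> 0"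
    if "r \<in> A" "s \<in> A" "t \<in> A" for r s t
    using no[OF that] no[OF that(1,3,2)] by (auto simp: ac_simps)
  show ?thesis
    unfolding sidon_def
  proof (intro ballI impI)
    fix r s t u
    assume mem: "r \<in> insert v A" "s \<in> insert v A" "t \<in> insert v A" "u \<in> insert v A"
      and sum: "r + s + t + u = 0"
    have 1: "r = s \<Longrightarrow> t = u" "r = t \<Longrightarrow> s = u" "r = u \<Longrightarrow> s = t" "s = t \<Longrightarrow> r = u" "s = u \<Longrightarrow> r = t" "t = u \<Longrightarrow> r = s"
      using sum by (auto simp: ac_simps)
    show "r = s \<or> r = t \<or> r = u"
    proof (rule ccontr)
      assume neg: "\<not> (r = s \<or> r = t \<or> r = u)"
      then have neq: "s \<noteq> t" "s \<noteq> u" "t \<noteq> u" using 1 by blast+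
      show False
      proof (cases "r \<in> A \<and> s \<in> A \<and> t \<in> A \<and> u \<in> A")
        case True
        then show False using assms(1) sum neg unfolding sidon_def by blast
      next
        case False
        then show False using mem neg neq sum no' by (metis insert_iff)
      qed
    qed
  qed
qed

context sidon_graph
begin

lemma sum_chi_subgp_nonneg: "subgp L \<Longrightarrow> 0 \<le> (\<Sum>p\<in>L. chi p v)"
  by (simp add: sum_chi_subgp)

text \<open>The square of \<open>psi\<close> is a sum over pairs of points, and every pair contributes a
  nonnegative amount to the sum over a subgroup. Only the equal pairs and those with sum \<open>\<sigma>\<close>
  are kept.\<close>

lemma sum_psi_square_subgp_ge:
  assumes "subgp L" "L \<subseteq> {p. chi p \<sigma> = 1}"
  shows "int (card L) * (a + of_bool (\<sigma> \<noteq> 0) * rep A 2 \<sigma>) \<le> (\<Sum>p\<in>L. (psi A p)\<^sup>2)"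
proof -
  let ?c = "int (card L)"
  have "?c * (a + of_bool (\<sigma> \<noteq> 0) * rep A 2 \<sigma>)
      = (\<Sum>s\<in>A. ?c + of_bool (\<sigma> \<noteq> 0) * (?c * of_bool (\<sigma> + s \<in> A)))"
    by (simp add: sum.distrib rep_2 a Int_def distrib_left flip: sum_distrib_left)
  also have "\<dots> = (\<Sum>s\<in>A. \<Sum>t\<in>A. ?c * of_bool (t = s) + of_bool (\<sigma> \<noteq> 0) * (?c * of_bool (t = \<sigma> + s)))"
  proof (intro sum.cong refl)
    fix s assume "s \<in> A"
    have *: "(\<Sum>t\<in>A. of_bool (t = x)) = (of_bool (x \<in> A) :: int)" for x
      by (simp add: of_bool_def)
    show "?c + of_bool (\<sigma> \<noteq> 0) * (?c * of_bool (\<sigma> + s \<in> A))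
      = (\<Sum>t\<in>A. ?c * of_bool (t = s) + of_bool (\<sigma> \<noteq> 0) * (?c * of_bool (t = \<sigma> + s)))"
      using \<open>s \<in> A\<close> by (simp only: sum.distrib * flip: sum_distrib_left) simp
  qed
  also have "\<dots> \<le> (\<Sum>s\<in>A. \<Sum>t\<in>A. \<Sum>p\<in>L. chi p (s + t))"
  proof (intro sum_mono)
    fix s t
    have eq: "(\<Sum>p\<in>L. chi p \<sigma>) = ?c" using assms(2) by (subst sum_chi_subgp[OF assms(1)]) auto
    consider "t = s" "\<sigma> \<noteq> 0 \<longrightarrow> t \<noteq> \<sigma> + s" | "t \<noteq> s" "t = \<sigma> + s" | "t \<noteq> s" "t \<noteq> \<sigma> + s"
      by (metis add_cancel_left_left)
    then show "?c * of_bool (t = s) + of_bool (\<sigma> \<noteq> 0) * (?c * of_bool (t = \<sigma> + s)) \<le> (\<Sum>p\<in>L. chi p (s + t))"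
    proof cases
      case 2
      then have "s + t = \<sigma>" by (simp add: ac_simps)
      then have "(\<Sum>p\<in>L. chi p (s + t)) = ?c" by (simp only: eq)
      then show ?thesis using 2(1) by (simp add: of_bool_def)
    qed (use sum_chi_subgp_nonneg[OF assms(1)] in auto)
  qed
  also have "\<dots> = (\<Sum>p\<in>L. (psi A p)\<^sup>2)"
    using psi_square_sum[where L = L and v = 0] by simp
  finally show ?thesis .
qed

end

text \<open>The square root \<open>r\<close> of \<open>N\<close> is a multiple of 8 because an even dimension that is at least 5
  is at least 6.\<close>

locale four_missing = sidon_graph A b N a
  for A :: "((bit ^ 'n) \<times> (bit ^ 'n)) set" and b :: "bit ^ 'n" and N a :: int +
  fixes r :: int
  assumes n: "even CARD('n)" and d: "a = N - 4" and r: "N = r\<^sup>2" "8 dvd r" "8 \<le> r"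
begin

text \<open>By \<open>psi_mod_4\<close>, \<open>psi\<close> is 0 modulo 4 on \<open>K\<close> and 2 modulo 4 off \<open>K\<close>; on \<open>Q\<close> it is 4 modulo
  8.\<close>

definition K where "K = {p. chi p \<sigma> = 1}"
definition Q where "Q = {p \<in> K. \<not> 8 dvd psi A p}"

lemma N64: "64 dvd N"
  using r by (auto simp: power2_eq_square elim!: dvdE)

lemma subgp_K: "subgp K"
  by (auto simp: subgp_def K_def chi_add_left)

lemma compl_K: "p \<notin> K \<longleftrightarrow> chi p \<sigma> = - 1"
  using chi_cases[of p \<sigma>] by (auto simp: K_def)

lemma psi_K: "p \<in> K \<Longrightarrow> 4 dvd psi A p"
  using psi_mod_4(1)[of p A] N64 d a by (simp add: K_def) presburger

lemma psi_not_K: "p \<notin> K \<Longrightarrow> 4 dvd psi A p - 2"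
  using psi_mod_4(2)[of p A] N64 d a by (simp add: compl_K) presburger

lemma psi_Q: "p \<in> Q \<Longrightarrow> 8 dvd psi A p - 4"
  using psi_K[of p] by (auto simp: Q_def) presburger

lemma psi_K_not_Q: "p \<in> K \<Longrightarrow> p \<notin> Q \<Longrightarrow> 8 dvd psi A p"
  by (auto simp: Q_def)

definition eps where "eps p = (if 8 dvd psi A p then 1 else (- 1 :: int))"

definition common where "common p q = int (card {t \<in> A. chi p t = 1 \<and> chi q t = 1})"

lemma eps_quad:
  assumes "c \<in> K" "p \<in> K" "q \<in> K"
  shows "eps c * eps (c + p) * eps (c + q) * eps (c + p + q) = (if even (common p q) then 1 else - 1)"
proof -
  have mem: "c + p \<in> K" "c + q \<in> K" "c + p + q \<in> K" using assms subgp_K by (auto simp: subgp_def)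
  obtain x y z w where xyzw: "psi A c = 4 * x" "psi A (c + p) = 4 * y" "psi A (c + q) = 4 * z" "psi A (c + p + q) = 4 * w"
    using psi_K[OF assms(1)] psi_K[OF mem(1)] psi_K[OF mem(2)] psi_K[OF mem(3)] by (auto elim!: dvdE)
  have e: "eps p' = (if even x' then 1 else - 1)" if "psi A p' = 4 * x'" for p' x'
    using that by (auto simp: eps_def)
  obtain m where "4 * x + 4 * y + 4 * z + 4 * w = 4 * common p q + 8 * m"
    using psi_four_term[of A c p q] xyzw by (auto simp: common_def)
  then have "x + y + z + w = common p q + 2 * m" by simp
  then show ?thesis unfolding xyzw[THEN e] sign_product_4 by simp
qed

lemma eps_quadratic: "sign_quadratic K eps"
proof
  show "eps c * eps (c + p) * eps (c + q) * eps (c + p + q) = eps 0 * eps p * eps q * eps (p + q)"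
    if "c \<in> K" "p \<in> K" "q \<in> K" for c p q
    using eps_quad[OF that] eps_quad[of 0 p q] subgp_K that by (simp add: subgp_def)
qed (rule subgp_K, simp add: eps_def)

lemma eps_0: "eps 0 = - 1"
  using N64 by (simp add: eps_def psi_0 d) presburger

lemma Q_eq: "Q = {c \<in> K. eps c = - 1}"
  by (auto simp: Q_def eps_def)

text \<open>At the other two bad characters \<open>psi\<close> is \<open>a\<close>.\<close>

definition bad_rest where "bad_rest = {p \<in> bad. fst p \<noteq> 0}"

lemma psi_B: "p \<in> bad_rest \<Longrightarrow> \<bar>psi A p\<bar> \<le> 4"
  using psi_bad_le d by (simp add: bad_rest_def)

lemma psi_B_Q: "p \<in> bad_rest \<Longrightarrow> p \<in> Q \<Longrightarrow> psi A p = 4 \<or> psi A p = - 4"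
  using psi_B[of p] psi_Q[of p] by presburger

lemma psi_B_K: "p \<in> bad_rest \<Longrightarrow> p \<in> K \<Longrightarrow> p \<notin> Q \<Longrightarrow> psi A p = 0"
  using psi_B[of p] psi_K_not_Q[of p] by presburger

lemma psi_B_odd: "p \<in> bad_rest \<Longrightarrow> p \<notin> K \<Longrightarrow> psi A p = 2 \<or> psi A p = - 2"
  using psi_B[of p] psi_not_K[of p] by presburger

definition count_Q where "count_Q = int (card (bad_rest \<inter> Q))"
definition count_K where "count_K = int (card (bad_rest \<inter> (K - Q)))"
definition count_odd where "count_odd = int (card (bad_rest - K))"

text \<open>All weights summed below are polynomials in \<open>psi\<close> chosen separately on \<open>Q\<close>, on the rest of
  \<open>K\<close>, and off \<open>K\<close>. On the bad characters they take one value per part, so three counts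
  determine their sum.\<close>

definition piece where
  "piece f g h p = (if p \<in> Q then f (psi A p) else if p \<in> K then g (psi A p) else (h (psi A p) :: int))"

lemma Q_K: "Q \<subseteq> K"
  by (auto simp: Q_def)

lemma zero_Q: "0 \<in> Q"
  using eps_0 subgp_K by (simp add: Q_eq subgp_def)

lemma b_K: "(0, b) \<in> K"
  using chi_0b hyp_sigma by (simp add: K_def)

lemma psi_b: "psi A (0, b) = a"
  using psi_shift[of 0] psi_0 by simp

lemma b_Q: "(0, b) \<in> Q"
  using b_K zero_Q by (simp add: Q_def psi_b psi_0)

lemma piece_same: "piece f f f p = f (psi A p)"
  by (simp add: piece_def)

lemma sum_B_piece:
  assumes "\<And>y. f (- y) = f y" "\<And>y. h (- y) = h y"
  shows "(\<Sum>p\<in>bad_rest. piece f g h p) = count_Q * f 4 + count_K * g 0 + count_odd * h 2"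
proof -
  have split: "bad_rest = (bad_rest \<inter> Q \<union> bad_rest \<inter> (K - Q)) \<union> (bad_rest - K)" using Q_K by auto
  have "(\<Sum>p\<in>bad_rest. piece f g h p) = (\<Sum>p\<in>bad_rest \<inter> Q. piece f g h p) + (\<Sum>p\<in>bad_rest \<inter> (K - Q). piece f g h p) + (\<Sum>p\<in>bad_rest - K. piece f g h p)"
    by (subst split, subst sum.union_disjoint) (use Q_K in \<open>auto intro!: sum.union_disjoint\<close>)
  also have "(\<Sum>p\<in>bad_rest \<inter> Q. piece f g h p) = (\<Sum>p\<in>bad_rest \<inter> Q. f 4)"
  proof (intro sum.cong refl)
    fix p assume "p \<in> bad_rest \<inter> Q"
    then show "piece f g h p = f 4" using psi_B_Q[of p] assms(1)[of 4] by (auto simp: piece_def)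
  qed
  also have "(\<Sum>p\<in>bad_rest \<inter> (K - Q). piece f g h p) = (\<Sum>p\<in>bad_rest \<inter> (K - Q). g 0)"
  proof (intro sum.cong refl)
    fix p assume "p \<in> bad_rest \<inter> (K - Q)"
    then show "piece f g h p = g 0" using psi_B_K[of p] by (auto simp: piece_def)
  qed
  also have "(\<Sum>p\<in>bad_rest - K. piece f g h p) = (\<Sum>p\<in>bad_rest - K. h 2)"
  proof (intro sum.cong refl)
    fix p assume "p \<in> bad_rest - K"
    then show "piece f g h p = h 2" using psi_B_odd[of p] assms(2)[of 2] Q_K by (auto simp: piece_def)
  qed
  finally show ?thesis by (simp add: count_Q_def count_K_def count_odd_def)
qed

lemma sum_bad_piece:
  assumes "\<And>y. f (- y) = f y" "\<And>y. h (- y) = h y"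
  shows "(\<Sum>p\<in>bad. piece f g h p) = 2 * f a + count_Q * f 4 + count_K * g 0 + count_odd * h 2"
  using sum_split_bad_0[of "piece f g h"] sum_B_piece[where f = f and g = g and h = h] assms zero_Q b_Q
  by (simp add: bad_rest_def piece_def psi_0 psi_b)

lemma counts_total: "count_Q + count_K + count_odd = 2 * N - 2"
  using sum_bad_piece[of "\<lambda>_. 1" "\<lambda>_. 1" "\<lambda>_. 1"] card_bad by (simp add: piece_same)

lemma counts_square: "4 * count_Q + count_odd = 2 * N - 8"
proof -
  have "(\<Sum>p\<in>bad. (psi A p)\<^sup>2) = (\<Sum>p\<in>bad. piece power2 power2 power2 p)"
    by (simp add: piece_same)
  also have "\<dots> = 2 * a\<^sup>2 + 16 * count_Q + 4 * count_odd"
    by (subst sum_bad_piece) simp_all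
  finally have "2 * N * a = 2 * a\<^sup>2 + 16 * count_Q + 4 * count_odd" by (simp add: sum_psi_square_bad)
  then show ?thesis by (simp add: d power2_eq_square algebra_simps)
qed

lemma counts_sigma: "count_odd = (if fst \<sigma> = 0 then 0 else N)"
proof -
  have "(\<Sum>p\<in>bad. chi p \<sigma>) = (\<Sum>p\<in>bad. piece (\<lambda>_. 1) (\<lambda>_. 1) (\<lambda>_. - 1) p)"
    using Q_K compl_K by (intro sum.cong refl) (auto simp: piece_def K_def)
  also have "\<dots> = 2 + count_Q + count_K - count_odd" by (subst sum_bad_piece) simp_all
  finally show ?thesis using sum_chi_bad[OF hyp_sigma] counts_total by (cases "fst \<sigma> = 0") auto
qed

end

context four_missing
begin

text \<open>Since \<open>r\<close> is a multiple of 8, the admissible values of \<open>psi\<close> next to \<open>r\<close> are \<open>r\<close> on \<open>K\<close>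
  outside \<open>Q\<close>, \<open>r \<plusminus> 4\<close> on \<open>Q\<close> and \<open>r \<plusminus> 2\<close> off \<open>K\<close>. The quartics take their minimum over the
  respective classes at these values, namely 0, \<open>64 * N - 256\<close> and 0.\<close>

definition even_quartic where "even_quartic y = (y\<^sup>2 - N)\<^sup>2 - 32 * (y\<^sup>2 - N)"
definition odd_quartic where "odd_quartic y = (y\<^sup>2 - N - 4)\<^sup>2 - 16 * N"

lemma even_quartic_nonneg:
  assumes "8 dvd y"
  shows "0 \<le> even_quartic y"
proof -
  have "32 dvd y\<^sup>2" using assms by (auto simp: power2_eq_square elim!: dvdE)
  then have "32 dvd y\<^sup>2 - N - 32" using N64 by presburger
  from consecutive_nonneg[OF this] show ?thesis by (simp add: even_quartic_def power2_eq_square algebra_simps)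
qed

lemma even_quartic_ge:
  assumes "8 dvd y - 4"
  shows "64 * N - 256 \<le> even_quartic y"
proof -
  have "8 dvd y - 4 - r" "8 dvd y - 4 + r" using assms r(2) by simp_all
  from mult_nonneg_nonneg[OF consecutive_nonneg[OF this(1)] consecutive_nonneg[OF this(2)]]
  show ?thesis unfolding even_quartic_def unfolding r(1) by (simp add: power2_eq_square algebra_simps)
qed

lemma odd_quartic_eq: "odd_quartic y = ((y - 2)\<^sup>2 - N) * ((y + 2)\<^sup>2 - N)"
  unfolding odd_quartic_def by algebra

lemma odd_quartic_nonneg:
  assumes "4 dvd y - 2"
  shows "0 \<le> odd_quartic y"
proof -
  have "4 dvd r" using r(2) by presburger
  then have "4 dvd y - 2 - r" "4 dvd y - 2 + r" using assms by simp_all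
  from mult_nonneg_nonneg[OF consecutive_nonneg[OF this(1)] consecutive_nonneg[OF this(2)]]
  show ?thesis unfolding odd_quartic_eq unfolding r(1) by (simp add: power2_eq_square algebra_simps)
qed

definition dev where "dev p = (psi A p)\<^sup>2 - N"

definition c0 where "c0 = (if \<sigma> = 0 then N\<^sup>2 else 0)"

lemma moments_D:
  shows "(\<Sum>p\<in>UNIV. (dev p)\<^sup>2) = N\<^sup>2 * (2 * N\<^sup>2 - 18 * N + 56)"
    and "(\<Sum>p\<in>UNIV. dev p) = - 4 * N\<^sup>2"
    and "(\<Sum>p\<in>UNIV. chi p \<sigma> * dev p) = N\<^sup>2 * rep A 2 \<sigma> - N * c0"
    and "(\<Sum>p\<in>UNIV. chi p \<sigma>) = c0"
proof -
  note card = psi_moments(6)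
  have "(dev p)\<^sup>2 = psi A p ^ 4 - 2 * N * (psi A p)\<^sup>2 + N\<^sup>2" for p unfolding dev_def by algebra
  then have "(\<Sum>p\<in>UNIV. (dev p)\<^sup>2) = N\<^sup>2 * (a * (3 * a - 2)) - 2 * N * (N\<^sup>2 * a) + N\<^sup>2 * N\<^sup>2"
    by (simp only: sum.distrib sum_subtractf psi_moments sum_constant card flip: sum_distrib_left)
  then show "(\<Sum>p\<in>UNIV. (dev p)\<^sup>2) = N\<^sup>2 * (2 * N\<^sup>2 - 18 * N + 56)"
    unfolding d by algebra
  have "(\<Sum>p\<in>UNIV. dev p) = N\<^sup>2 * a - N\<^sup>2 * N"
    by (simp only: dev_def sum_subtractf psi_moments sum_constant card)
  then show "(\<Sum>p\<in>UNIV. dev p) = - 4 * N\<^sup>2" unfolding d by algebra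
  have "chi p \<sigma> * dev p = (psi A p)\<^sup>2 * chi p \<sigma> - N * chi p \<sigma>" for p unfolding dev_def by algebra
  then show "(\<Sum>p\<in>UNIV. chi p \<sigma> * dev p) = N\<^sup>2 * rep A 2 \<sigma> - N * c0"
    by (simp only: sum_subtractf psi_moments sum_chi_UNIV c0_def flip: sum_distrib_left)
  show "(\<Sum>p\<in>UNIV. chi p \<sigma>) = c0" by (simp only: sum_chi_UNIV c0_def)
qed

lemma sum_piece_good:
  assumes "\<And>y. f (- y) = f y" "\<And>y. h (- y) = h y"
  shows "(\<Sum>p\<in>- bad. piece f g h p) = (\<Sum>p\<in>UNIV. piece f g h p) - (2 * f a + count_Q * f 4 + count_K * g 0 + count_odd * h 2)"
  using sum_split_bad[of "piece f g h"] sum_bad_piece[where f = f and g = g and h = h] assms by simp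

lemma card_Q_good: "(\<Sum>p\<in>- bad. of_bool (p \<in> Q)) = int (card Q) - (2 + count_Q)"
proof -
  have "of_bool (p \<in> Q) = piece (\<lambda>_. 1) (\<lambda>_. 0) (\<lambda>_. 0) p" for p by (simp add: piece_def)
  then have "(\<Sum>p\<in>- bad. of_bool (p \<in> Q)) = (\<Sum>p\<in>UNIV. of_bool (p \<in> Q)) - (2 + count_Q)"
    using sum_piece_good[of "\<lambda>_. 1" "\<lambda>_. 0" "\<lambda>_. 0"] by simp
  then show ?thesis by simp
qed

lemma card_K: "2 * int (card K) = N\<^sup>2 + c0"
proof -
  have "2 * of_bool (p \<in> K) = 1 + chi p \<sigma>" for p
    using chi_cases[of p \<sigma>] by (auto simp: K_def)
  then have "(\<Sum>p\<in>UNIV. 2 * of_bool (p \<in> K)) = (\<Sum>p\<in>UNIV. 1 + chi p \<sigma>)" by simp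
  also have "\<dots> = N\<^sup>2 + c0" by (simp only: sum.distrib moments_D sum_constant psi_moments(6))
  finally show ?thesis by (simp flip: sum_distrib_left)
qed

lemma sum_quartics: "2 * (\<Sum>p\<in>UNIV. piece even_quartic even_quartic odd_quartic p)
    = 2 * (N\<^sup>2 * (2 * N\<^sup>2 - 18 * N + 56)) + 160 * N\<^sup>2 - 24 * (N\<^sup>2 * rep A 2 \<sigma> - N * c0) + (16 - 16 * N) * (N\<^sup>2 - c0)"
proof -
  have "2 * piece even_quartic even_quartic odd_quartic p = 2 * (dev p)\<^sup>2 - 40 * dev p
      - 24 * (chi p \<sigma> * dev p) + ((16 - 16 * N) - (16 - 16 * N) * chi p \<sigma>)" for p
  proof (cases "p \<in> K")
    case True
    then show ?thesis by (simp add: piece_def even_quartic_def K_def dev_def)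
  next
    case False
    then have "chi p \<sigma> = - 1" "p \<notin> Q" using compl_K[of p] Q_K by auto
    then show ?thesis using False
      by (simp add: piece_def odd_quartic_def dev_def power2_eq_square algebra_simps)
  qed
  then have "(\<Sum>p\<in>UNIV. 2 * piece even_quartic even_quartic odd_quartic p) = 2 * (N\<^sup>2 * (2 * N\<^sup>2 - 18 * N + 56))
      - 40 * (- 4 * N\<^sup>2) - 24 * (N\<^sup>2 * rep A 2 \<sigma> - N * c0) + (N\<^sup>2 * 16 - N\<^sup>2 * (16 * N) - (16 - 16 * N) * c0)"
    by (simp only: sum.distrib sum_subtractf moments_D sum_constant psi_moments(6) flip: sum_distrib_left)
  then show ?thesis by (simp add: algebra_simps flip: sum_distrib_left)
qed

lemma rep_sigma:
  shows "\<sigma> = 0 \<Longrightarrow> rep A 2 \<sigma> = N - 4" and "0 \<le> rep A 2 \<sigma>"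
    and "\<sigma> \<noteq> 0 \<Longrightarrow> fst \<sigma> = 0 \<Longrightarrow> rep A 2 \<sigma> = 0"
proof -
  show "\<sigma> = 0 \<Longrightarrow> rep A 2 \<sigma> = N - 4" using rep_2_0[of A] a d by simp
  show "0 \<le> rep A 2 \<sigma>" by (rule rep_nonneg)
  assume s: "\<sigma> \<noteq> 0" "fst \<sigma> = 0"
  have "\<sigma> + t \<notin> A" if "t \<in> A" for t
  proof
    assume "\<sigma> + t \<in> A"
    moreover have "fst (\<sigma> + t) = fst t" using s by simp
    ultimately have "\<sigma> + t = t" using inj that by (metis inj_onD)
    then show False using s by simp
  qed
  then show "rep A 2 \<sigma> = 0" by (simp add: rep_2)
qed

text \<open>If \<open>Q\<close> had density at least 3/8 in \<open>K\<close>, the minimum \<open>64 * N - 256\<close> on \<open>Q\<close> would make the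
  sum of the quartics larger than the moments allow.\<close>

lemma Q_few: "\<not> 3 * card K \<le> 8 * card Q"
proof
  assume "3 * card K \<le> 8 * card Q"
  then have "3 * int (card K) \<le> 8 * int (card Q)" by linarith
  then have big: "3 * (N\<^sup>2 + c0) \<le> 16 * int (card Q)" using card_K by simp
  define S where "S = (\<Sum>p\<in>- bad. piece even_quartic even_quartic odd_quartic p)"
  have "(\<Sum>p\<in>- bad. (64 * N - 256) * of_bool (p \<in> Q)) \<le> S"
    unfolding S_def
  proof (rule sum_mono)
    fix p
    show "(64 * N - 256) * of_bool (p \<in> Q) \<le> piece even_quartic even_quartic odd_quartic p"
      using even_quartic_ge[OF psi_Q[of p]] even_quartic_nonneg[OF psi_K_not_Q[of p]] odd_quartic_nonneg[OF psi_not_K[of p]]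
      by (auto simp: piece_def)
  qed
  then have "(64 * N - 256) * (int (card Q) - (2 + count_Q)) \<le> S"
    by (simp only: card_Q_good flip: sum_distrib_left)
  moreover have N64': "64 \<le> N" using N64 N_pos by (auto elim!: dvdE)
  have "(64 * N - 256) * (3 * (N\<^sup>2 + c0) - 16 * (2 + count_Q)) \<le> (64 * N - 256) * (16 * (int (card Q) - (2 + count_Q)))"
    using big N64' by (intro mult_left_mono) auto
  ultimately have ineq: "(64 * N - 256) * (3 * (N\<^sup>2 + c0) - 16 * (2 + count_Q)) \<le> 16 * S" by linarith
  have S: "2 * S = 2 * (N\<^sup>2 * (2 * N\<^sup>2 - 18 * N + 56)) + 160 * N\<^sup>2 - 24 * (N\<^sup>2 * rep A 2 \<sigma> - N * c0)
      + (16 - 16 * N) * (N\<^sup>2 - c0) - 2 * (2 * even_quartic (N - 4) + count_Q * even_quartic 4 + count_K * even_quartic 0 + count_odd * odd_quartic 2)"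
    unfolding S_def using sum_piece_good[of even_quartic odd_quartic even_quartic] sum_quartics
    by (simp add: even_quartic_def odd_quartic_def d)
  obtain M where M: "N = 4 * M" using N64 by (auto elim!: dvdE intro: that[of "16 * _"])
  have S16: "16 * S = 8 * (2 * S)" by simp
  consider "\<sigma> = 0" | "\<sigma> \<noteq> 0" "fst \<sigma> = 0" | "fst \<sigma> \<noteq> 0" by auto
  then have "16 * S - (64 * N - 256) * (3 * (N\<^sup>2 + c0) - 16 * (2 + count_Q)) < 0"
  proof cases
    case 1
    then have e: "count_odd = 0" "count_Q = 2 * M - 2" "count_K = 6 * M"
      using counts_sigma counts_square counts_total M by auto
    have e': "c0 = N\<^sup>2" "rep A 2 \<sigma> = N - 4" using rep_sigma(1)[OF 1] 1 by (simp_all add: c0_def)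
    have "16 * S - (64 * N - 256) * (3 * (N\<^sup>2 + c0) - 16 * (2 + count_Q)) = N\<^sup>2 * (1664 - 128 * N)"
      unfolding S16 S e e' unfolding even_quartic_def odd_quartic_def unfolding M by (simp add: power2_eq_square algebra_simps)
    then show ?thesis using N64' by (simp add: mult_pos_neg)
  next
    case 2
    then have "c0 = 0" by (simp add: c0_def)
    moreover have "count_odd = 0" "count_Q = 2 * M - 2" "count_K = 6 * M" "rep A 2 \<sigma> = 0"
      using 2 counts_sigma counts_square counts_total rep_sigma(3) M by auto
    ultimately have e: "count_odd = 0" "count_Q = 2 * M - 2" "count_K = 6 * M" "rep A 2 \<sigma> = 0" "c0 = 0" by simp_all
    have "16 * S - (64 * N - 256) * (3 * (N\<^sup>2 + c0) - 16 * (2 + count_Q)) = N\<^sup>2 * (256 - 64 * N)"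
      unfolding S16 S e unfolding even_quartic_def odd_quartic_def unfolding M by (simp add: power2_eq_square algebra_simps)
    then show ?thesis using N64' by (simp add: mult_pos_neg)
  next
    case 3
    then have "c0 = 0" by (auto simp: c0_def)
    moreover have "count_odd = N" "count_Q = M - 2" "count_K = 3 * M"
      using 3 counts_sigma counts_square counts_total M by auto
    ultimately have e: "count_odd = N" "count_Q = M - 2" "count_K = 3 * M" "c0 = 0" by simp_all
    have "16 * S - (64 * N - 256) * (3 * (N\<^sup>2 + c0) - 16 * (2 + count_Q)) = N\<^sup>2 * (640 - 192 * rep A 2 \<sigma> - 64 * N)"
      unfolding S16 S e unfolding even_quartic_def odd_quartic_def unfolding M by (simp add: power2_eq_square algebra_simps)
    then show ?thesis using N64' rep_sigma(2) by (simp add: mult_pos_neg)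
  qed
  then show False using ineq by simp
qed

lemma Q_subgp: "subgp Q" and Q_card: "4 * int (card Q) = int (card K)"
proof -
  interpret sign_quadratic K eps by (rule eps_quadratic)
  have "subgp Q \<and> 4 * card Q = card K"
    using quadratic_density[OF eps_0] Q_few unfolding Q_eq by blast
  then show "subgp Q" "4 * int (card Q) = int (card K)" by linarith+
qed

lemma sum_Q_D: "(\<Sum>p\<in>UNIV. of_bool (p \<in> Q) * dev p) = (\<Sum>p\<in>Q. (psi A p)\<^sup>2) - N * int (card Q)"
proof -
  have "(\<Sum>p\<in>UNIV. of_bool (p \<in> Q) * dev p) = (\<Sum>p\<in>Q. (psi A p)\<^sup>2 - N)"
    by (rule sum.mono_neutral_cong_right) (auto simp: dev_def)
  then show ?thesis by (simp add: sum_subtractf)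
qed

text \<open>If \<open>\<sigma> = 0\<close>, then \<open>K\<close> contains all characters. Outside \<open>Q\<close> the quartic is now replaced by
  the one with roots \<open>\<plusminus>r\<close> and \<open>\<plusminus>(r - 8)\<close>; as \<open>Q\<close> is a subgroup, the sum of \<open>psi\<^sup>2\<close> over \<open>Q\<close>
  is bounded from below, and the total is negative.\<close>

lemma sigma_nonzero: "\<sigma> \<noteq> 0"
proof
  assume \<sigma>: "\<sigma> = 0"
  define \<kappa> where "\<kappa> = 16 * r - 64"
  define f where "f y = even_quartic y - (64 * N - 256)" for y
  define g where "g y = (y\<^sup>2 - N)\<^sup>2 + \<kappa> * (y\<^sup>2 - N)" for y
  have g_nonneg: "0 \<le> g y" if "8 dvd y" for y
  proof -
    have "8 dvd y - (r - 8)" "8 dvd y + (r - 8)" using that r(2) by presburger+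
    from quartic_nonneg[OF this] show ?thesis
      unfolding g_def \<kappa>_def r(1) by (simp add: power2_eq_square algebra_simps)
  qed
  have K: "p \<in> K" for p using \<sigma> by (simp add: K_def)
  have "0 \<le> (\<Sum>p\<in>- bad. piece f g (\<lambda>_. 0) p)"
  proof (rule sum_nonneg)
    fix p
    show "0 \<le> piece f g (\<lambda>_. 0) p"
      using even_quartic_ge[OF psi_Q[of p]] g_nonneg[OF psi_K_not_Q[of p]] K by (auto simp: piece_def f_def)
  qed
  also have "\<dots> = (\<Sum>p\<in>UNIV. piece f g (\<lambda>_. 0) p) - (2 * f a + count_Q * f 4 + count_K * g 0)"
    by (subst sum_piece_good) (simp_all add: f_def even_quartic_def)
  also have "(\<Sum>p\<in>UNIV. piece f g (\<lambda>_. 0) p)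
      = (\<Sum>p\<in>UNIV. (dev p)\<^sup>2 + \<kappa> * dev p
        - ((32 + \<kappa>) * (of_bool (p \<in> Q) * dev p) + (64 * N - 256) * of_bool (p \<in> Q)))"
    using K by (intro sum.cong refl) (simp add: piece_def f_def g_def even_quartic_def dev_def algebra_simps)
  also have "\<dots> = N\<^sup>2 * (2 * N\<^sup>2 - 18 * N + 56) + \<kappa> * (- 4 * N\<^sup>2)
      - ((32 + \<kappa>) * ((\<Sum>p\<in>Q. (psi A p)\<^sup>2) - N * int (card Q)) + (64 * N - 256) * int (card Q))"
    by (simp only: sum.distrib sum_subtractf moments_D sum_Q_D flip: sum_distrib_left) simp
  finally have ge: "0 \<le> N\<^sup>2 * (2 * N\<^sup>2 - 18 * N + 56) + \<kappa> * (- 4 * N\<^sup>2)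
      - ((32 + \<kappa>) * ((\<Sum>p\<in>Q. (psi A p)\<^sup>2) - N * int (card Q)) + (64 * N - 256) * int (card Q))
      - (2 * f a + count_Q * f 4 + count_K * g 0)" .
  have "(32 + \<kappa>) * (int (card Q) * a) \<le> (32 + \<kappa>) * (\<Sum>p\<in>Q. (psi A p)\<^sup>2)"
    using sum_psi_square_subgp_ge[OF Q_subgp] Q_K \<sigma> r(3)
    by (intro mult_left_mono) (auto simp: K_def \<kappa>_def)
  then have ge2: "0 \<le> N\<^sup>2 * (2 * N\<^sup>2 - 18 * N + 56) + \<kappa> * (- 4 * N\<^sup>2)
      - ((32 + \<kappa>) * (int (card Q) * a - N * int (card Q)) + (64 * N - 256) * int (card Q))
      - (2 * f a + count_Q * f 4 + count_K * g 0)"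
    using ge by (simp add: right_diff_distrib)
  obtain M where M: "N = 4 * M" using N64 by (auto elim!: dvdE intro: that[of "16 * _"])
  have "c0 = N\<^sup>2" using \<sigma> by (simp add: c0_def)
  then have "4 * int (card Q) = N\<^sup>2" using Q_card card_K by simp
  then have "int (card Q) = 4 * M\<^sup>2" unfolding M by (simp add: power2_eq_square)
  moreover have "count_Q = 2 * M - 2" "count_K = 6 * M"
    using counts_sigma counts_square counts_total \<sigma> M by auto
  ultimately have e: "count_Q = 2 * M - 2" "count_K = 6 * M" "int (card Q) = 4 * M\<^sup>2" by simp_all
  have "N\<^sup>2 * (2 * N\<^sup>2 - 18 * N + 56) + \<kappa> * (- 4 * N\<^sup>2)
      - ((32 + \<kappa>) * (int (card Q) * a - N * int (card Q)) + (64 * N - 256) * int (card Q))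
      - (2 * f a + count_Q * f 4 + count_K * g 0) = N\<^sup>2 * (120 - 24 * r)"
    unfolding e unfolding f_def g_def even_quartic_def \<kappa>_def d unfolding M by (simp add: power2_eq_square algebra_simps)
  moreover have "N\<^sup>2 * (120 - 24 * r) < 0" using r(3) N_pos by (simp add: mult_pos_neg)
  ultimately show False using ge2 by simp
qed

text \<open>Now the quartic outside \<open>Q\<close> is replaced by \<open>(y\<^sup>2 - N)\<^sup>2\<close>. The upper bound from the moments
  is exactly 0, so every term vanishes.\<close>

lemma odd_quartic_zero:
  assumes "p \<notin> bad" "p \<notin> K"
  shows "odd_quartic (psi A p) = 0"
proof -
  define f where "f y = even_quartic y - (64 * N - 256)" for y
  define g where "g y = (y\<^sup>2 - N)\<^sup>2" for y
  define P where "P = piece f g odd_quartic"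
  have P_nonneg: "0 \<le> P p" for p
    using even_quartic_ge[OF psi_Q[of p]] odd_quartic_nonneg[OF psi_not_K[of p]]
    by (auto simp: P_def piece_def f_def g_def)
  have c0: "c0 = 0" using sigma_nonzero by (simp add: c0_def)
  have P_eq: "2 * P p = 2 * (dev p)\<^sup>2 - (64 * (of_bool (p \<in> Q) * dev p) + (128 * N - 512) * of_bool (p \<in> Q))
      - 8 * dev p + 8 * (chi p \<sigma> * dev p) + ((16 - 16 * N) - (16 - 16 * N) * chi p \<sigma>)" for p
  proof (cases "p \<in> K")
    case True
    then show ?thesis by (simp add: P_def piece_def f_def g_def even_quartic_def K_def dev_def)
  next
    case False
    then have "chi p \<sigma> = - 1" "p \<notin> Q" using compl_K[of p] Q_K by auto
    then show ?thesis using False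
      by (simp add: P_def piece_def odd_quartic_def dev_def power2_eq_square algebra_simps)
  qed
  have all: "2 * (\<Sum>p\<in>UNIV. P p) = 2 * (N\<^sup>2 * (2 * N\<^sup>2 - 18 * N + 56))
      - (64 * ((\<Sum>p\<in>Q. (psi A p)\<^sup>2) - N * int (card Q)) + (128 * N - 512) * int (card Q))
      + 32 * N\<^sup>2 + 8 * (N\<^sup>2 * rep A 2 \<sigma>) + (16 - 16 * N) * N\<^sup>2"
  proof -
    have "(\<Sum>p\<in>UNIV. of_bool (p \<in> Q)) = int (card Q)" by simp
    then have "(\<Sum>p\<in>UNIV. 2 * P p) = 2 * (N\<^sup>2 * (2 * N\<^sup>2 - 18 * N + 56))
      - (64 * ((\<Sum>p\<in>Q. (psi A p)\<^sup>2) - N * int (card Q)) + (128 * N - 512) * int (card Q))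
      - 8 * (- 4 * N\<^sup>2) + 8 * (N\<^sup>2 * rep A 2 \<sigma> - N * c0) + (N\<^sup>2 * 16 - N\<^sup>2 * (16 * N) - (16 - 16 * N) * c0)"
      by (simp only: P_eq sum.distrib sum_subtractf moments_D sum_Q_D sum_constant psi_moments(6) flip: sum_distrib_left)
    then show ?thesis by (simp add: c0 left_diff_distrib mult.commute[of "N\<^sup>2"] flip: sum_distrib_left)
  qed
  have good: "(\<Sum>p\<in>- bad. P p) = (\<Sum>p\<in>UNIV. P p) - (2 * f a + count_Q * f 4 + count_K * g 0 + count_odd * odd_quartic 2)"
    unfolding P_def by (subst sum_piece_good) (simp_all add: f_def even_quartic_def odd_quartic_def)
  have ge: "int (card Q) * (a + rep A 2 \<sigma>) \<le> (\<Sum>p\<in>Q. (psi A p)\<^sup>2)"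
    using sum_psi_square_subgp_ge[OF Q_subgp] Q_K sigma_nonzero by (simp add: K_def)
  have Q8: "8 * int (card Q) = N\<^sup>2" using Q_card card_K c0 by simp
  have "2 * (\<Sum>p\<in>- bad. P p) \<le> 2 * (N\<^sup>2 * (2 * N\<^sup>2 - 18 * N + 56))
      - (64 * (int (card Q) * (a + rep A 2 \<sigma>) - N * int (card Q)) + (128 * N - 512) * int (card Q))
      + 32 * N\<^sup>2 + 8 * (N\<^sup>2 * rep A 2 \<sigma>) + (16 - 16 * N) * N\<^sup>2
      - 2 * (2 * f a + count_Q * f 4 + count_K * g 0 + count_odd * odd_quartic 2)" (is "_ \<le> ?U")
    unfolding good right_diff_distrib[of 2 "sum P UNIV"] all
    by (intro diff_right_mono add_right_mono diff_left_mono mult_left_mono ge) simp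
  also have "?U = 0"
  proof -
    obtain M where M: "N = 8 * M" using N64 by (auto elim!: dvdE intro: that[of "8 * _"])
    have Q8: "int (card Q) = 8 * M\<^sup>2" using Q8 M by (simp add: power2_eq_square)
    show ?thesis
    proof (cases "fst \<sigma> = 0")
      case True
      then have e: "count_odd = 0" "count_Q = 4 * M - 2" "count_K = 12 * M" "rep A 2 \<sigma> = 0"
        using counts_sigma counts_square counts_total rep_sigma(3) sigma_nonzero M by auto
      show ?thesis unfolding e Q8 unfolding f_def g_def even_quartic_def odd_quartic_def d unfolding M by (simp add: power2_eq_square algebra_simps)
    next
      case False
      then have e: "count_odd = N" "count_Q = 2 * M - 2" "count_K = 6 * M"
        using counts_sigma counts_square counts_total M by auto
      show ?thesis unfolding e Q8 unfolding f_def g_def even_quartic_def odd_quartic_def d unfolding M by (simp add: power2_eq_square algebra_simps)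
    qed
  qed
  finally have "(\<Sum>p\<in>- bad. P p) = 0" using sum_nonneg[of "- bad" P] P_nonneg by auto
  then have "P p = 0" using assms(1) P_nonneg by (simp add: sum_nonneg_eq_0_iff)
  moreover have "p \<notin> Q" using assms(2) Q_K by blast
  ultimately show ?thesis using assms(2) by (simp add: P_def piece_def)
qed

end

context four_missing
begin

text \<open>Off \<open>K\<close> and outside the bad characters, the previous lemma leaves \<open>psi = \<plusminus>r + 2 * eta\<close>.
  Modulo 8 this is \<open>2 * eta\<close>, so \<open>eta\<close> is again quadratic, with the same second differences
  as \<open>eps\<close>.\<close>

definition eta where "eta p = (if 8 dvd psi A p - 2 then 1 else (- 1 :: int))"

lemma eta_cases: "eta p = 1 \<or> eta p = - 1"
  by (simp add: eta_def)

lemma add_K: "c \<notin> K \<Longrightarrow> p \<in> K \<Longrightarrow> c + p \<notin> K" "c \<notin> K \<Longrightarrow> c' \<notin> K \<Longrightarrow> c + c' \<in> K"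
  using compl_K[of c] compl_K[of c'] compl_K[of "c + p"] by (auto simp: K_def chi_add_left)

lemma eta_quad:
  assumes "c \<notin> K" "p \<in> K" "q \<in> K"
  shows "eta c * eta (c + p) * eta (c + q) * eta (c + p + q) = (if even (common p q) then 1 else - 1)"
proof -
  have mem: "c + p \<notin> K" "c + q \<notin> K" "c + p + q \<notin> K" using assms add_K(1) by blast+
  obtain x y z w where xyzw: "psi A c - 2 = 4 * x" "psi A (c + p) - 2 = 4 * y"
      "psi A (c + q) - 2 = 4 * z" "psi A (c + p + q) - 2 = 4 * w"
    using psi_not_K[OF assms(1)] psi_not_K[OF mem(1)] psi_not_K[OF mem(2)] psi_not_K[OF mem(3)]
    by (meson dvdE)
  have e: "eta p' = (if even x' then 1 else - 1)" if "psi A p' - 2 = 4 * x'" for p' x'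
    using that by (auto simp: eta_def)
  obtain m where "psi A c + psi A (c + p) + psi A (c + q) + psi A (c + p + q) = 4 * common p q + 8 * m"
    using psi_four_term[of A c p q] by (auto simp: common_def)
  then have "x + y + z + w = common p q + 2 * (m - 1)" using xyzw by simp
  then have "even (x + y + z + w) \<longleftrightarrow> even (common p q)" by presburger
  then show ?thesis unfolding xyzw[THEN e] sign_product_4 by simp
qed

text \<open>As \<open>Q\<close> is a subgroup on whose cosets in \<open>K\<close> the function \<open>eps\<close> is constant, it lies in the
  radical of the polar form.\<close>

lemma common_even:
  assumes "p \<in> Q" "q \<in> K"
  shows "even (common p q)"
proof -
  have pK: "p \<in> K" using assms(1) Q_K by auto
  have pqK: "p + q \<in> K" using pK assms(2) subgp_K by (auto simp: subgp_def)
  have "p + (p + q) = q" by simp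
  then have "p + q \<in> Q \<longleftrightarrow> q \<in> Q" using Q_subgp assms(1) unfolding subgp_def by metis
  then have "eps (p + q) = eps q" using pqK assms(2) by (auto simp: Q_def eps_def)
  moreover have "eps p = - 1" using assms(1) by (simp add: Q_eq)
  moreover have "eps 0 * eps (0 + p) * eps (0 + q) * eps (0 + p + q) = (if even (common p q) then 1 else - 1)"
    using zero_Q Q_K pK assms(2) by (intro eps_quad) auto
  moreover have "eps q * eps q = 1" by (simp add: eps_def)
  ultimately show ?thesis using eps_0 by (simp add: mult.assoc split: if_splits)
qed

lemma eta_ratio:
  assumes "p \<in> Q" "c \<notin> K" "c' \<notin> K"
  shows "eta c * eta (c + p) = eta c' * eta (c' + p)"
proof -
  have q: "c + c' \<in> K" using add_K(2) assms by blast
  have "eta c * eta (c + p) * eta (c + (c + c')) * eta (c + p + (c + c')) = 1"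
    using eta_quad[OF assms(2) _ q, of p] common_even[OF assms(1) q] assms(1) Q_K by auto
  moreover have "c + (c + c') = c'" "c + p + (c + c') = c' + p" by (simp_all add: ac_simps)
  ultimately have "eta c * eta (c + p) * eta c' * eta (c' + p) = 1" by simp
  then show ?thesis
    using eta_cases[of c] eta_cases[of "c + p"] eta_cases[of c'] eta_cases[of "c' + p"] by auto
qed

definition F where "F v = (\<Sum>c\<in>- K. eta c * chi c v)"
definition autocorr where "autocorr p = (\<Sum>c\<in>- K. eta c * eta (c + p))"

lemma F_square: "(F v)\<^sup>2 = (\<Sum>p\<in>K. autocorr p * chi p v)"
proof -
  have "(F v)\<^sup>2 = (\<Sum>c\<in>- K. \<Sum>c'\<in>- K. eta c * eta c' * chi (c + c') v)"
    by (simp add: F_def power2_eq_square sum_product chi_add_left mult_ac)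
  also have "\<dots> = (\<Sum>c\<in>- K. \<Sum>p\<in>K. eta c * eta (c + p) * chi p v)"
  proof (rule sum.cong[OF refl])
    fix c assume c: "c \<in> - K"
    have "(\<Sum>p\<in>K. eta c * eta (p + c) * chi (c + (p + c)) v) = (\<Sum>c'\<in>- K. eta c * eta c' * chi (c + c') v)"
      by (rule sum_translate) (use c add_K in \<open>auto simp: add.commute[of _ c]\<close>)
    moreover have "c + (p + c) = p" for p by (simp add: ac_simps)
    ultimately show "(\<Sum>c'\<in>- K. eta c * eta c' * chi (c + c') v) = (\<Sum>p\<in>K. eta c * eta (c + p) * chi p v)"
      by (simp add: add.commute)
  qed
  also have "\<dots> = (\<Sum>p\<in>K. autocorr p * chi p v)"
    by (subst sum.swap) (simp add: autocorr_def sum_distrib_right)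
  finally show ?thesis .
qed

lemma c0_0: "c0 = 0"
  using sigma_nonzero by (simp add: c0_def)

lemma card_compl_K: "2 * int (card (- K)) = N\<^sup>2"
proof -
  have "card K + card (- K) = card (UNIV :: ((bit ^ 'n) \<times> (bit ^ 'n)) set)"
    by (subst card_Un_disjoint[symmetric]) (auto intro: arg_cong[where f = card])
  then have "int (card K) + int (card (- K)) = N\<^sup>2" by (metis of_nat_add psi_moments(6))
  then show ?thesis using card_K c0_0 by simp
qed

lemma N_sq: "N\<^sup>2 = (2 ^ CARD('n))\<^sup>2"
  by (simp add: N)

lemma F_moment_2: "2 * (\<Sum>v\<in>UNIV. (F v)\<^sup>2) = N ^ 4"
proof -
  have "(\<Sum>v\<in>UNIV. (F v)\<^sup>2) = N\<^sup>2 * (\<Sum>c\<in>- K. (eta c)\<^sup>2)"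
    unfolding F_def N_sq by (rule parseval)
  also have "(\<Sum>c\<in>- K. (eta c)\<^sup>2) = (\<Sum>c\<in>- K. 1)"
    using eta_cases by (intro sum.cong refl) (auto simp: eta_def)
  finally have "2 * (\<Sum>v\<in>UNIV. (F v)\<^sup>2) = N\<^sup>2 * (2 * int (card (- K)))" by simp
  then show ?thesis by (simp add: card_compl_K flip: power_add)
qed

text \<open>The derivative of \<open>eta\<close> in a direction \<open>p \<in> Q\<close> is constant off \<open>K\<close>, so the autocorrelation
  attains its largest possible absolute value at all these \<open>p\<close>.\<close>

lemma F_moment_4: "N ^ 8 \<le> 32 * (\<Sum>v\<in>UNIV. ((F v)\<^sup>2)\<^sup>2)"
proof -
  have "(\<Sum>v\<in>UNIV. ((F v)\<^sup>2)\<^sup>2) = N\<^sup>2 * (\<Sum>p\<in>K. (autocorr p)\<^sup>2)"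
    unfolding F_square N_sq by (rule parseval)
  moreover have "(\<Sum>p\<in>Q. (int (card (- K)))\<^sup>2) \<le> (\<Sum>p\<in>K. (autocorr p)\<^sup>2)"
  proof -
    have "(autocorr p)\<^sup>2 = (int (card (- K)))\<^sup>2" if "p \<in> Q" for p
    proof (cases "- K = {}")
      case False
      then obtain c where c: "c \<notin> K" by blast
      have "autocorr p = (\<Sum>c'\<in>- K. eta c * eta (c + p))"
        unfolding autocorr_def by (intro sum.cong refl eta_ratio) (use that c in auto)
      then have "autocorr p = int (card (- K)) * (eta c * eta (c + p))" by simp
      then show ?thesis using eta_cases[of c] eta_cases[of "c + p"] by auto
    qed (simp add: autocorr_def)
    then have "(\<Sum>p\<in>Q. (int (card (- K)))\<^sup>2) = (\<Sum>p\<in>Q. (autocorr p)\<^sup>2)" by simp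
    also have "\<dots> \<le> (\<Sum>p\<in>K. (autocorr p)\<^sup>2)" using Q_K by (intro sum_mono2) auto
    finally show ?thesis .
  qed
  ultimately have "32 * (N\<^sup>2 * (int (card Q) * (int (card (- K)))\<^sup>2)) \<le> 32 * (\<Sum>v\<in>UNIV. ((F v)\<^sup>2)\<^sup>2)"
    by (simp add: mult_left_mono)
  moreover have "32 * (N\<^sup>2 * (int (card Q) * (int (card (- K)))\<^sup>2)) = N\<^sup>2 * (8 * int (card Q)) * (2 * int (card (- K)))\<^sup>2"
    by (simp add: power2_eq_square)
  moreover have "8 * int (card Q) = N\<^sup>2" using Q_card card_K c0_0 by simp
  ultimately show ?thesis by (simp add: card_compl_K flip: power_add power_mult)
qed

text \<open>The sum of \<open>(F v)\<^sup>4\<close> divided by that of \<open>(F v)\<^sup>2\<close> is a lower bound for the maximum of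
  \<open>(F v)\<^sup>2\<close>; the sign of \<open>F v\<close> is changed by passing from \<open>v\<close> to \<open>v + \<sigma>\<close>.\<close>

lemma F_large: "\<exists>v. N\<^sup>2 \<le> 4 * F v"
proof -
  obtain M where M: "N = 8 * M" using N64 by (auto elim!: dvdE intro: that[of "8 * _"])
  have "\<exists>v. (16 * M\<^sup>2)\<^sup>2 \<le> (F v)\<^sup>2"
  proof (rule ccontr)
    assume "\<not> (\<exists>v. (16 * M\<^sup>2)\<^sup>2 \<le> (F v)\<^sup>2)"
    then have "(F v)\<^sup>2 < (16 * M\<^sup>2)\<^sup>2" for v by (metis not_le)
    then have small: "(F v)\<^sup>2 \<le> (16 * M\<^sup>2)\<^sup>2 - 1" for v using zle_diff1_eq by blast
    have "((F v)\<^sup>2)\<^sup>2 \<le> ((16 * M\<^sup>2)\<^sup>2 - 1) * (F v)\<^sup>2" for v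
      unfolding power2_eq_square[of "(F v)\<^sup>2"] by (rule mult_right_mono[OF small]) simp
    then have "(\<Sum>v\<in>UNIV. ((F v)\<^sup>2)\<^sup>2) \<le> ((16 * M\<^sup>2)\<^sup>2 - 1) * (\<Sum>v\<in>UNIV. (F v)\<^sup>2)"
      by (simp only: sum_distrib_left) (rule sum_mono)
    then have "N ^ 8 \<le> 16 * (((16 * M\<^sup>2)\<^sup>2 - 1) * (2 * (\<Sum>v\<in>UNIV. (F v)\<^sup>2)))"
      using F_moment_4 by linarith
    also have "\<dots> = N ^ 8 - 16 * N ^ 4"
      unfolding F_moment_2 M by (simp add: power_mult_distrib algebra_simps flip: power_mult power_add)
    finally show False using N_pos by simp
  qed
  then obtain v where "(16 * M\<^sup>2)\<^sup>2 \<le> (F v)\<^sup>2" by blast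
  then have "16 * M\<^sup>2 \<le> \<bar>F v\<bar>"
    by (metis abs_le_square_iff abs_of_nonneg zero_le_power2 mult_nonneg_nonneg zero_le_numeral)
  moreover have "F (v + \<sigma>) = - F v"
  proof -
    have "F (v + \<sigma>) = (\<Sum>c\<in>- K. - (eta c * chi c v))"
      unfolding F_def using compl_K by (intro sum.cong refl) (simp add: chi_add_right)
    then show ?thesis by (simp add: F_def sum_negf)
  qed
  ultimately have "16 * M\<^sup>2 \<le> F v \<or> 16 * M\<^sup>2 \<le> F (v + \<sigma>)" by linarith
  then obtain u where "16 * M\<^sup>2 \<le> F u" by blast
  then have "N\<^sup>2 \<le> 4 * F u" by (simp add: M power_mult_distrib)
  then show ?thesis by blast
qed

lemma F_hyp:
  assumes "F v \<noteq> 0"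
  shows "bdot b (snd v) = 0"
proof (rule ccontr)
  assume "bdot b (snd v) \<noteq> 0"
  then have chi: "chi (0, b) v = - 1" by (simp add: chi_def)
  have "(\<Sum>c\<in>- K. eta (c + (0, b)) * chi (c + (0, b)) v) = F v"
    unfolding F_def
    by (rule sum_translate) (use b_K add_K(1) in auto)
  moreover have "eta (c + (0, b)) = eta c" for c by (simp add: eta_def psi_shift)
  ultimately have "- F v = F v" by (simp add: F_def chi chi_add_left sum_negf)
  then show False using assms by simp
qed

lemma sum_compl_K: "2 * (\<Sum>p\<in>- K \<inter> L. f p) = (\<Sum>p\<in>L. f p) - (\<Sum>p\<in>L. f p * chi p \<sigma>)"
  for f :: "_ \<Rightarrow> int"
proof -
  have "2 * (\<Sum>p\<in>- K \<inter> L. f p) = (\<Sum>p\<in>- K \<inter> L. f p - f p * chi p \<sigma>)"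
    using compl_K by (simp only: sum_distrib_left) (intro sum.cong refl, auto)
  also have "\<dots> = (\<Sum>p\<in>L. f p - f p * chi p \<sigma>)"
    by (rule sum.mono_neutral_left) (auto simp: K_def)
  finally show ?thesis by (simp add: sum_subtractf)
qed

text \<open>If \<open>psi = u + 2 * eta\<close> with \<open>u\<^sup>2 = N\<close>, a combination of \<open>psi\<^sup>3\<close> and \<open>psi\<close> isolates \<open>eta\<close>.
  On the bad characters \<open>u\<close> is replaced by 0.\<close>

lemma cube_off_K:
  assumes "p \<notin> K"
  shows "psi A p ^ 3 - (N + 12) * psi A p = 4 * (N - 4) * eta p - of_bool (p \<in> bad) * (3 * N * psi A p)"
proof (cases "p \<in> bad")
  case True
  have "p \<in> bad_rest"
  proof (rule ccontr)
    assume "p \<notin> bad_rest"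
    then have "p \<in> {p \<in> bad. fst p = 0}" using True by (auto simp: bad_rest_def)
    then have "p = 0 \<or> p = (0, b)" unfolding bad_0 by blast
    then show False using assms b_K subgp_K by (auto simp: subgp_def)
  qed
  then have "psi A p = 2 \<or> psi A p = - 2" using psi_B_odd assms by blast
  then show ?thesis
  proof
    assume "psi A p = 2" then show ?thesis using True by (simp add: eta_def algebra_simps)
  next
    assume "psi A p = - 2" then show ?thesis using True by (simp add: eta_def algebra_simps)
  qed
next
  case False
  have "((psi A p - 2) - r) * ((psi A p - 2) + r) * ((psi A p + 2) - r) * ((psi A p + 2) + r) = 0"
    using odd_quartic_zero[OF False assms] unfolding odd_quartic_eq unfolding r(1)
    by (simp add: power2_eq_square algebra_simps)
  then consider "psi A p = 2 + r" | "psi A p = 2 - r" | "psi A p = - 2 + r" | "psi A p = - 2 - r" by auto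
  then obtain u e where ue: "psi A p = 2 * e + u" "u\<^sup>2 = N" "e = 1 \<and> 8 dvd u \<or> e = - 1 \<and> 8 dvd u"
  proof cases
    case 1 then show thesis using r by (intro that[of 1 r]) auto
  next
    case 2 then show thesis using r by (intro that[of 1 "- r"]) auto
  next
    case 3 then show thesis using r by (intro that[of "- 1" r]) auto
  next
    case 4 then show thesis using r by (intro that[of "- 1" "- r"]) auto
  qed
  have "eta p = e" using ue(1,3) unfolding eta_def by presburger
  moreover have "(2 * e + u) ^ 3 - (u\<^sup>2 + 12) * (2 * e + u) = 4 * (u\<^sup>2 - 4) * e"
    using ue(3) by (auto simp: power2_eq_square power3_eq_cube algebra_simps)
  ultimately show ?thesis
    using False unfolding ue(1) ue(2)[symmetric] by simp
qed

text \<open>Since the third moment counts triples, a large Fourier coefficient of \<open>eta\<close> at \<open>v\<close> makes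
  the numbers of representations of \<open>v\<close> and \<open>v + \<sigma>\<close> differ as much as possible.\<close>

lemma third_moment:
  assumes v: "bdot b (snd v) = 0"
  shows "N\<^sup>2 * (rep A 3 v - rep A 3 (v + \<sigma>) - (N + 12) * (of_bool (v \<in> A) - of_bool (v + \<sigma> \<in> A)))
    = 8 * (N - 4) * F v - 6 * N\<^sup>2 * (of_bool (fst v \<in> fst ` A) - of_bool (fst (v + \<sigma>) \<in> fst ` A))"
proof -
  let ?X = "\<lambda>p. psi A p ^ 3 * chi p v - (N + 12) * (psi A p * chi p v)"
  have "2 * (\<Sum>p\<in>- K \<inter> UNIV. ?X p) = (\<Sum>p\<in>UNIV. ?X p) - (\<Sum>p\<in>UNIV. ?X p * chi p \<sigma>)"
    by (rule sum_compl_K)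
  also have "(\<Sum>p\<in>UNIV. ?X p * chi p \<sigma>) = (\<Sum>p\<in>UNIV. psi A p ^ 3 * chi p (v + \<sigma>) - (N + 12) * (psi A p * chi p (v + \<sigma>)))"
    by (simp add: chi_add_right algebra_simps)
  finally have 1: "2 * (\<Sum>p\<in>- K. ?X p) = N\<^sup>2 * rep A 3 v - (N + 12) * (N\<^sup>2 * of_bool (v \<in> A))
      - (N\<^sup>2 * rep A 3 (v + \<sigma>) - (N + 12) * (N\<^sup>2 * of_bool (v + \<sigma> \<in> A)))"
    by (simp only: sum_subtractf psi_moments Int_UNIV_right flip: sum_distrib_left)
  have "2 * (\<Sum>p\<in>- K \<inter> bad. psi A p * chi p v) = (\<Sum>p\<in>bad. psi A p * chi p v) - (\<Sum>p\<in>bad. psi A p * chi p v * chi p \<sigma>)"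
    by (rule sum_compl_K)
  also have "(\<Sum>p\<in>bad. psi A p * chi p v * chi p \<sigma>) = (\<Sum>p\<in>bad. psi A p * chi p (v + \<sigma>))"
    by (simp add: chi_add_right mult.assoc)
  finally have 2: "2 * (\<Sum>p\<in>- K \<inter> bad. psi A p * chi p v)
      = 2 * N * of_bool (fst v \<in> fst ` A) - 2 * N * of_bool (fst (v + \<sigma>) \<in> fst ` A)"
    using hyp_add[OF v hyp_sigma] v by (simp only: sum_psi_bad)
  have "(\<Sum>p\<in>- K. ?X p) = (\<Sum>p\<in>- K. 4 * (N - 4) * (eta p * chi p v) - 3 * N * (of_bool (p \<in> bad) * (psi A p * chi p v)))"
  proof (rule sum.cong[OF refl])
    fix p assume "p \<in> - K"
    then have "?X p = (4 * (N - 4) * eta p - of_bool (p \<in> bad) * (3 * N * psi A p)) * chi p v"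
      using cube_off_K[of p] by (metis ComplD left_diff_distrib mult.assoc)
    then show "?X p = 4 * (N - 4) * (eta p * chi p v) - 3 * N * (of_bool (p \<in> bad) * (psi A p * chi p v))"
      by (simp add: algebra_simps)
  qed
  also have "\<dots> = 4 * (N - 4) * F v - 3 * N * (\<Sum>p\<in>- K. of_bool (p \<in> bad) * (psi A p * chi p v))"
    by (simp only: sum_subtractf F_def flip: sum_distrib_left)
  also have "(\<Sum>p\<in>- K. of_bool (p \<in> bad) * (psi A p * chi p v)) = (\<Sum>p\<in>- K \<inter> bad. psi A p * chi p v)"
    by (rule sum.mono_neutral_cong_right) auto
  finally have 3: "(\<Sum>p\<in>- K. ?X p) = 4 * (N - 4) * F v - 3 * N * (\<Sum>p\<in>- K \<inter> bad. psi A p * chi p v)" .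
  show ?thesis using 1 2 3 by algebra
qed

text \<open>For the \<open>v\<close> of \<open>F_large\<close>, the point \<open>v + \<sigma>\<close> lies above a missing first coordinate and is
  not a sum of three points of \<open>A\<close>. Adding it to \<open>A\<close> yields a Sidon graph with only three
  missing points.\<close>

lemma impossible: False
proof -
  obtain v where v: "N\<^sup>2 \<le> 4 * F v" using F_large by blast
  then have "F v \<noteq> 0" using N_pos by auto
  then have hv: "bdot b (snd v) = 0" by (rule F_hyp)
  define p where "p = v + \<sigma>"
  have hp: "bdot b (snd p)  = 0" unfolding p_def by (rule hyp_add[OF hv hyp_sigma])
  have N64': "64 \<le> N" using N64 N_pos by (auto elim!: dvdE)
  define Tv Tp :: int where "Tv = of_bool (fst v \<in> fst ` A)" and "Tp = of_bool (fst p \<in> fst ` A)"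
  have "N\<^sup>2 * (2 * (N - 4) - 6 * (Tv - Tp)) \<le> 2 * (N - 4) * (4 * F v) - 6 * N\<^sup>2 * (Tv - Tp)"
    using mult_left_mono[OF v, of "2 * (N - 4)"] N64' by (simp add: algebra_simps)
  also have "\<dots> = N\<^sup>2 * (rep A 3 v - rep A 3 p - (N + 12) * (of_bool (v \<in> A) - of_bool (p \<in> A)))"
    using third_moment[OF hv] by (simp add: Tv_def Tp_def p_def)
  finally have ineq: "2 * (N - 4) - 6 * (Tv - Tp) \<le> rep A 3 v - rep A 3 p - (N + 12) * (of_bool (v \<in> A) - of_bool (p \<in> A))"
    using N_pos by simp
  have inT: "Tv = 1" if "v \<in> A" using that by (simp add: Tv_def)
  have inT': "Tp = 1" if "p \<in> A" using that by (simp add: Tp_def)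
  have T: "Tv = 0 \<or> Tv = 1" "Tp = 0 \<or> Tp = 1" by (auto simp: Tv_def Tp_def)
  have rv: "rep A 3 v = 3 * N - 14" if "v \<in> A" using rep_3_member[OF sidon that] a d by simp
  have rp: "rep A 3 p = 3 * N - 14" if "p \<in> A" using rep_3_member[OF sidon that] a d by simp
  have rv': "rep A 3 v \<le> 2 * N - 8" if "v \<notin> A" using rep_3_le[OF sidon that] a d by simp
  have rv'': "rep A 3 v \<le> 2 * N - 10" if "v \<notin> A" "Tv = 1"
    using rep_3_le_above[OF that(1)] that(2) d by (simp add: Tv_def split: if_splits)
  have pos: "0 \<le> rep A 3 p" by (rule rep_nonneg)
  have pA: "p \<notin> A"
  proof
    assume p: "p \<in> A"
    show False
    proof (cases "v \<in> A")
      case True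
      then show False using ineq p inT inT' rv rp N64' by simp
    next
      case False
      then show False using ineq p inT' rv' rp N64' T by auto
    qed
  qed
  have vA: "v \<notin> A"
  proof
    assume "v \<in> A"
    then show False using ineq pA inT rv pos N64' T by auto
  qed
  have ineq': "2 * (N - 4) - 6 * (Tv - Tp) \<le> rep A 3 v - rep A 3 p" using ineq vA pA by simp
  have Tp: "Tp = 0" using ineq' T rv' rv'' vA pos by auto
  have "rep A 3 p \<le> 4"
    using ineq' T rv' rv'' vA Tp by auto
  moreover have "2 dvd rep A 3 p" "3 dvd rep A 3 p" using rep_3_even[OF sidon pA] rep_3_dvd_3[OF pA] by auto
  ultimately have r0: "rep A 3 p = 0" using pos by presburger
  have fp: "fst p \<notin> fst ` A" using Tp by (simp add: Tp_def)
  interpret E: sidon_graph "insert p A" b N "N - 3"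
  proof
    show "inj_on fst (insert p A)" unfolding inj_on_insert using inj fp by blast
    show "sidon (insert p A)" by (rule sidon_insert[OF sidon r0])
    show "bdot b (snd t) = 0" if "t \<in> insert p A" for t using that hyp[of t] hp by auto
    show "N - 3 = int (card (insert p A))" using pA a d by simp
  qed (rule b N)+
  have "5 \<le> CARD('n)"
  proof (rule ccontr)
    assume "\<not> 5 \<le> CARD('n)"
    then have "(2 :: int) ^ CARD('n) \<le> 2 ^ 4" by (intro power_increasing) auto
    then show False using N64' N by simp
  qed
  then show False using E.no_three_missing n by blast
qed

end

lemma (in sidon_graph) no_four_missing:
  assumes n: "even CARD('n)" "5 \<le> CARD('n)" and d: "a = N - 4"
  shows False
proof -
  obtain r :: int where r: "2 ^ CARD('n) = r\<^sup>2" "8 dvd r" "8 \<le> r" using even_power_square[OF n] by metis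
  then interpret four_missing A b N a r using n d N by unfold_locales auto
  show False by (rule impossible)
qed

section \<open>The linearity of an APN function\<close>

lemma sidon_graph_subset:
  assumes "sidon_graph A b N a" "B \<subseteq> A"
  shows "sidon_graph B b N (int (card B))"
proof -
  interpret sidon_graph A b N a by (rule assms)
  show ?thesis
  proof
    show "inj_on fst B" using inj assms(2) by (rule inj_on_subset)
    show "sidon B" using sidon assms(2) unfolding sidon_def by blast
    show "bdot b (snd t) = 0" if "t \<in> B" for t using that hyp[of t] assms(2) by blast
  qed (rule b N refl)+
qed

text \<open>Otherwise \<open>x1\<close>, \<open>x2\<close>, \<open>x3\<close> are three solutions of the equation with \<open>h = x1 + x2\<close>.\<close>

lemma apn_no_flat:
  assumes F: "apn F" and sum: "x1 + x2 + x3 + x4 = 0" "F x1 + F x2 + F x3 + F x4 = 0"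
  shows "x1 = x2 \<or> x1 = x3 \<or> x1 = x4"
proof (rule ccontr)
  assume neq: "\<not> ?thesis"
  define h y where "h = x1 + x2" and "y = F x1 + F x2"
  have "h \<noteq> 0" using neq by (simp add: h_def)
  have "x3 + h = x4" using sum(1) by (simp add: h_def ac_simps)
  moreover have "F x4 + F x3 = y" using sum(2) by (simp add: y_def ac_simps)
  moreover have "x1 + h = x2" "x2 + h = x1" by (simp_all add: h_def ac_simps)
  ultimately have "{x1, x2, x3} \<subseteq> {x. F (x + h) + F x = y}" by (simp add: y_def add.commute)
  then have "card {x1, x2, x3} \<le> card {x. F (x + h) + F x = y}" by (intro card_mono) auto
  also have "\<dots> \<le> 2" using F \<open>h \<noteq> 0\<close> unfolding apn_def by blast
  finally have "card {x1, x2, x3} \<le> 2" .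
  moreover have "x2 \<noteq> x3" using neq sum(1) by (auto simp: ac_simps)
  ultimately show False using neq by simp
qed

text \<open>Adding to \<open>F\<close> an affine function with values in \<open>{0, e}\<close>, where \<open>bdot b e = 1\<close>, moves the
  graph over the level set into the hyperplane orthogonal to \<open>b\<close>. It remains a Sidon set,
  and so do its subsets, hence it is enough to exclude the exact cardinalities treated
  above.\<close>

lemma level_set_card:
  fixes F :: "bit ^ 'n \<Rightarrow> bit ^ 'n"
  assumes n: "5 \<le> CARD('n)" and F: "apn F" and b: "b \<noteq> 0"
  shows "card {x. bdot b (F x) + bdot a x = c} + (if even CARD('n) then 5 else 3) \<le> 2 ^ CARD('n)"
proof (rule ccontr)
  let ?X = "{x. bdot b (F x) + bdot a x = c}"
  assume large: "\<not> ?thesis"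
  obtain e where e: "bdot b e = 1" using b by (metis bdot_commute bdot_nondegenerate)
  define G where "G x = F x + (bdot a x + c) *s e" for x
  define A where "A = (\<lambda>x. (x, G x)) ` ?X"
  have G4: "G x1 + G x2 + G x3 + G x4 = F x1 + F x2 + F x3 + F x4" if "x1 + x2 + x3 + x4 = 0" for x1 x2 x3 x4
  proof -
    have "G x1 + G x2 + G x3 + G x4 = F x1 + F x2 + F x3 + F x4
        + ((bdot a x1 + c) + (bdot a x2 + c) + (bdot a x3 + c) + (bdot a x4 + c)) *s e"
      by (simp only: G_def vector_sadd_rdistrib ac_simps)
    also have "(bdot a x1 + c) + (bdot a x2 + c) + (bdot a x3 + c) + (bdot a x4 + c)
        = bdot a (x1 + x2 + x3 + x4) + ((c + c) + (c + c))"
      by (simp only: bdot_add_right ac_simps)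
    finally show ?thesis using that by simp
  qed
  have "sidon_graph A b (2 ^ CARD('n)) (int (card A))"
  proof
    show "inj_on fst A" by (auto simp: A_def inj_on_def)
    show "sidon A"
      unfolding sidon_def
    proof (intro ballI impI)
      fix r s t u assume "r \<in> A" "s \<in> A" "t \<in> A" "u \<in> A" and sum: "r + s + t + u = 0"
      then obtain x1 x2 x3 x4 where x: "r = (x1, G x1)" "s = (x2, G x2)" "t = (x3, G x3)" "u = (x4, G x4)"
        by (auto simp: A_def)
      have "x1 + x2 + x3 + x4 = 0" "G x1 + G x2 + G x3 + G x4 = 0"
        using sum unfolding x by (simp_all add: zero_prod_def)
      then have "x1 = x2 \<or> x1 = x3 \<or> x1 = x4" using apn_no_flat[OF F] G4 by metis
      then show "r = s \<or> r = t \<or> r = u" using x by blast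
    qed
    show "bdot b (snd t) = 0" if "t \<in> A" for t
    proof -
      obtain x where x: "t = (x, G x)" "bdot b (F x) + bdot a x = c" using \<open>t \<in> A\<close> by (auto simp: A_def)
      have "bdot b ((bdot a x + c) *s e) = (bdot a x + c) * bdot b e"
        by (simp only: bdot_def vector_smult_component sum_distrib_left mult.left_commute)
      then have "bdot b (snd t) = (bdot b (F x) + bdot a x) + c"
        by (simp only: x(1) snd_conv G_def bdot_add_right e mult_1_right add.assoc)
      then show ?thesis by (simp only: x(2) bit_add_self)
    qed
  qed (use b in simp_all)
  note A = sidon_graph_subset[OF this]
  have cardA: "card A = card ?X" unfolding A_def by (rule card_image) (auto simp: inj_on_def)
  have big: "(2 :: nat) ^ 5 \<le> 2 ^ CARD('n)" using n by (intro power_increasing) auto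
  have sub: "\<exists>B\<subseteq>A. int (card B) = 2 ^ CARD('n) - int k" if "2 ^ CARD('n) \<le> card A + k" "k \<le> 4" for k
  proof -
    have "2 ^ CARD('n) - k \<le> card A" using that by simp
    then obtain B where "B \<subseteq> A" "card B = 2 ^ CARD('n) - k" by (rule obtain_subset_with_card_n)
    then show ?thesis using that big by (auto simp: of_nat_diff intro!: exI[of _ B])
  qed
  show False
  proof (cases "even CARD('n)")
    case False
    then obtain B where "B \<subseteq> A" "int (card B) = 2 ^ CARD('n) - 2"
      using sub[of 2] large cardA by auto
    then show False using sidon_graph.no_two_missing[OF A] False n by blast
  next
    case True
    then have "2 ^ CARD('n) \<le> card A + 4" using large cardA by simp
    then consider "2 ^ CARD('n) \<le> card A + 3" | "card A + 4 = 2 ^ CARD('n)" by linarith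
    then show False
    proof cases
      case 1
      then obtain B where "B \<subseteq> A" "int (card B) = 2 ^ CARD('n) - 3"
        using sub[of 3] by auto
      then show False using sidon_graph.no_three_missing[OF A] True n by blast
    next
      case 2
      then have "int (card A + 4) = int (2 ^ CARD('n))" by (simp only:)
      then have "int (card A) = 2 ^ CARD('n) - 4" by simp
      then show False using sidon_graph.no_four_missing[OF A[OF subset_refl]] True n by blast
    qed
  qed
qed

lemma walsh_level_sets:
  fixes f :: "bit ^ 'n \<Rightarrow> bit"
  shows "\<bar>walsh f a\<bar> = 2 * int (card {x. f x + bdot a x = 0}) - 2 ^ CARD('n)
    \<or> \<bar>walsh f a\<bar> = 2 * int (card {x. f x + bdot a x = 1}) - 2 ^ CARD('n)"
proof -
  let ?X = "\<lambda>c. {x. f x + bdot a x = c}"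
  have U: "UNIV = ?X 0 \<union> ?X 1" "?X 0 \<inter> ?X 1 = {}" by auto
  have "walsh f a = (\<Sum>x\<in>?X 0. (- 1) ^ of_bit (f x + bdot a x)) + (\<Sum>x\<in>?X 1. (- 1) ^ of_bit (f x + bdot a x))"
    unfolding walsh_def by (subst U(1), rule sum.union_disjoint) (use U(2) in auto)
  also have "(\<Sum>x\<in>?X 0. (- 1) ^ of_bit (f x + bdot a x)) = (\<Sum>x\<in>?X 0. (1 :: int))"
    by (intro sum.cong refl) simp
  also have "(\<Sum>x\<in>?X 1. (- 1) ^ of_bit (f x + bdot a x)) = (\<Sum>x\<in>?X 1. (- 1 :: int))"
    by (intro sum.cong refl) simp
  finally have w: "walsh f a = int (card (?X 0)) - int (card (?X 1))" by simp
  have "card (UNIV :: (bit ^ 'n) set) = card (?X 0) + card (?X 1)"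
    by (subst U(1), rule card_Un_disjoint) (use U(2) in auto)
  then have "2 ^ CARD('n) = int (card (?X 0)) + int (card (?X 1))"
    by (simp flip: of_nat_add)
  then show ?thesis using w by linarith
qed

theorem theorem1p1:
  fixes F :: "bit ^ 'n \<Rightarrow> bit ^ 'n"
  assumes "CARD('n) \<ge> 5" and "apn F"
  shows "linearity F \<le>
    (if even CARD('n) then 2 ^ CARD('n) - 10 else 2 ^ CARD('n) - 6)"
  unfolding linearity_def
proof (rule Max.boundedI)
  fix w assume "w \<in> {\<bar>walsh (component F b) a\<bar> | a b. b \<noteq> 0}"
  then obtain a b where ab: "b \<noteq> 0" "w = \<bar>walsh (component F b) a\<bar>" by auto
  have "int (card {x. component F b x + bdot a x = c}) + (if even CARD('n) then 5 else 3) \<le> 2 ^ CARD('n)" for c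
  proof -
    have "int (card {x. component F b x + bdot a x = c} + (if even CARD('n) then 5 else 3)) \<le> int (2 ^ CARD('n))"
      using level_set_card[OF assms ab(1), of a c] unfolding component_def by (simp only: of_nat_le_iff)
    then show ?thesis
      by (cases "even CARD('n)") (simp_all only: if_True if_False of_nat_add of_nat_power of_nat_numeral)
  qed
  from this[of 0] this[of 1] show "w \<le> (if even CARD('n) then 2 ^ CARD('n) - 10 else 2 ^ CARD('n) - 6)"
    using walsh_level_sets[of "component F b" a] ab(2) by (auto split: if_splits)
qed (rule linearity_set_finite_nonempty)+

end
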